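(* Let $\zeta\in L^{\infty}([0,T],\mathbb{R}^{d'})$, $\theta\in\Theta$, $\lambda>0$, and let $Q$ be a symmetric positive definite $d\times d$ matrix. Then there exists a unique pair $(\bar u_{\theta,\lambda},\widehat{x_0})\in L^2([0,T],\mathbb{R}^d)\times\mathbb{R}^d$ minimizing the cost $$C(\zeta;u,x_0,\theta,\lambda)=x_0^{T}Qx_0+\int_0^T\Big\{\|\zeta(t)-CX_{\theta,x_0,u}(t)\|_2^2+\lambda\|u(t)\|_2^2\Big\}dt .$$ The optimal control is $$\bar u_{\theta,\lambda}(t)=\frac{1}{\lambda}\Big(E_\theta(t)X_{\theta,\widehat{x_0},\bar u_{\theta,\lambda}}(t)+h_\theta(t,\zeta)\Big),$$ where $E_\theta$ and $h_\theta(\cdot,\zeta)$ solve the initial value problem $$\dot E_\theta=C^TC-A_\theta^TE_\theta-E_\theta A_\theta-\tfrac1\lambda E_\theta^2,\qquad \dot h_\theta(t,\zeta)=-\alpha_\theta(t)h_\theta(t,\zeta)-\beta_\theta(t,\zeta),$$ $(E_\theta(0),h_\theta(0,\zeta))=(Q,0)$, with $\alpha_\theta(t)=A_\theta(t)^T+\frac{1}{\lambda}E_\theta(t)$ and $\beta_\theta(t,\zeta)=C^T\zeta(t)+E_\theta(t)r_\theta(t)$. For all $t\in[0,T]$, $E_\theta(t)$ is symmetric (and $E_\theta(T)$ is nonsingular). Finally, the profiled cost $S(\zeta;\theta,\lambda)=\inf_{x_0\in\mathbb{R}^d}\inf_{u\in L^2}C(\zeta;u,x_0,\theta,\lambda)$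 has the closed form $$S(\zeta;\theta,\lambda)=\int_0^T\Big(\|\zeta(t)\|^2-2r_\theta(t)^Th_\theta(t,\zeta)-\tfrac1\lambda\|h_\theta(t,\zeta)\|^2\Big)dt-h_\theta(T,\zeta)^TE_\theta(T)^{-1}h_\theta(T,\zeta),$$ and the optimal final state is $X_{\theta,\widehat{x_0},\bar u_{\theta,\lambda}}(T)=-E_\theta(T)^{-1}h_\theta(T,\zeta)$.
   Context: Fix $T>0$, integers $d,d'\ge1$, an observation matrix $C\in\mathbb{R}^{d'\times d}$ and a parameter set $\Theta\subset\mathbb{R}^p$. For each $\theta\in\Theta$, $t\mapsto A_\theta(t)\in\mathbb{R}^{d\times d}$ and $t\mapsto r_\theta(t)\in\mathbb{R}^d$ are given (continuous) functions on $[0,T]$. For $x_0\in\mathbb{R}^d$ and a control $u\in L^2([0,T],\mathbb{R}^d)$, $X_{\theta,x_0,u}$ denotes the solution of the perturbed linear ODE $\dot x(t)=A_\theta(t)x(t)+r_\theta(t)+u(t)$, $x(0)=x_0$. $\|\cdot\|_2$ is the Euclidean norm. *)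

theory Defs
  imports "HOL-Analysis.Analysis"
begin

definition L2_on :: "real \<Rightarrow> (real \<Rightarrow> 'a::euclidean_space) \<Rightarrow> bool" where
  "L2_on T u \<longleftrightarrow> set_borel_measurable lborel {0..T} u
      \<and> set_integrable lborel {0..T} (\<lambda>t. (norm (u t))\<^sup>2)"

definition Linf_on :: "real \<Rightarrow> (real \<Rightarrow> 'a::euclidean_space) \<Rightarrow> bool" where
  "Linf_on T z \<longleftrightarrow> set_borel_measurable lborel {0..T} z
      \<and> (\<exists>B. AE t in lborel. t \<in> {0..T} \<longrightarrow> norm (z t) \<le> B)"

text \<open>(Caratheodory) solution on [0,T] of x' = A x + r + u, x(0) = x0, in integral form.\<close>
definition is_ode_sol ::
  "real \<Rightarrow> (real \<Rightarrow> real^'d^'d) \<Rightarrow> (real \<Rightarrow> real^'d) \<Rightarrow> real^'d \<Rightarrow> (real \<Rightarrow> real^'d)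
    \<Rightarrow> (real \<Rightarrow> real^'d) \<Rightarrow> bool" where
  "is_ode_sol T A r x0 u X \<longleftrightarrow>
     (\<forall>t\<in>{0..T}. ((\<lambda>s. A s *v X s + r s + u s) has_integral (X t - x0)) {0..t})"

definition traj ::
  "real \<Rightarrow> (real \<Rightarrow> real^'d^'d) \<Rightarrow> (real \<Rightarrow> real^'d) \<Rightarrow> real^'d \<Rightarrow> (real \<Rightarrow> real^'d)
    \<Rightarrow> real \<Rightarrow> real^'d" where
  "traj T A r x0 u = (THE X. is_ode_sol T A r x0 u X \<and> (\<forall>t. t \<notin> {0..T} \<longrightarrow> X t = 0))"

definition cost ::
  "real \<Rightarrow> real^'d^'e \<Rightarrow> real^'d^'d \<Rightarrow> (real \<Rightarrow> real^'d^'d) \<Rightarrow> (real \<Rightarrow> real^'d)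
    \<Rightarrow> real \<Rightarrow> (real \<Rightarrow> real^'e) \<Rightarrow> (real \<Rightarrow> real^'d) \<Rightarrow> real^'d \<Rightarrow> real" where
  "cost T C Q A r lam z u x0 =
     x0 \<bullet> (Q *v x0)
     + integral {0..T} (\<lambda>t. (norm (z t - C *v traj T A r x0 u t))\<^sup>2 + lam * (norm (u t))\<^sup>2)"

definition riccati_sol ::
  "real \<Rightarrow> real^'d^'e \<Rightarrow> real^'d^'d \<Rightarrow> (real \<Rightarrow> real^'d^'d) \<Rightarrow> real
    \<Rightarrow> (real \<Rightarrow> real^'d^'d) \<Rightarrow> bool" where
  "riccati_sol T C Q A lam E \<longleftrightarrow> E 0 = Q \<and>
     (\<forall>t\<in>{0..T}. (E has_vector_derivative
        (transpose C ** C - transpose (A t) ** E t - E t ** A t - (1/lam) *\<^sub>R (E t ** E t)))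
        (at t within {0..T}))"

text \<open>Linear equation h' = - alpha h - beta, h(0) = 0, on [0,T] (integral form, since zeta is
  only essentially bounded).\<close>
definition h_sol ::
  "real \<Rightarrow> real^'d^'e \<Rightarrow> (real \<Rightarrow> real^'d^'d) \<Rightarrow> (real \<Rightarrow> real^'d) \<Rightarrow> real
    \<Rightarrow> (real \<Rightarrow> real^'e) \<Rightarrow> (real \<Rightarrow> real^'d^'d) \<Rightarrow> (real \<Rightarrow> real^'d) \<Rightarrow> bool" where
  "h_sol T C A r lam z E h \<longleftrightarrow>
     (\<forall>t\<in>{0..T}. ((\<lambda>s. - ((transpose (A s) + (1/lam) *\<^sub>R E s) *v h s
                         + (transpose C *v z s + E s *v r s))) has_integral h t) {0..t})"

end

theory Submission
  imports Defs
begin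

text \<open>If \<open>E\<close> solves the Riccati equation and \<open>h\<close> the linear equation, then along every trajectory \<open>X\<close>
  driven by \<open>u\<close> the function \<open>X \<bullet> E X + 2 h \<bullet> X\<close> has derivative
  \<open>|\<zeta> - C X|\<^sup>2 + lam |u|\<^sup>2 - (|\<zeta>|\<^sup>2 - 2 r \<bullet> h - |h|\<^sup>2 / lam) - lam |u - (E X + h) / lam|\<^sup>2\<close>.
  Integrating, the terms at time 0 cancel against \<open>x\<^sub>0 \<bullet> Q x\<^sub>0\<close>, and completing the square at time \<open>T\<close> writes
  the cost as the claimed optimal value plus a positive definite quadratic form in
  \<open>X T + E(T)\<^sup>-\<^sup>1 h(T)\<close> plus \<open>lam\<close> times the squared distance of \<open>u\<close> from the feedback law. Both vanish
  exactly for the solution of the closed-loop equation with terminal value \<open>- E(T)\<^sup>-\<^sup>1 h(T)\<close>, which is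
  therefore the unique minimiser.\<close>

section \<open>Volterra equations and ordinary differential equations\<close>

text \<open>The penalty sits at time 0 and the final state is free, so the quadratic form has to be
  carried forward from \<open>Q\<close>, as a cost-to-come, and the state at time \<open>T\<close>
  parametrises what remains to be chosen. This reverses the usual direction of the linear-quadratic
  regulator and calls for terminal value problems. Two obstacles shape the rest. First,
  \<open>u\<close> and \<zeta> are merely integrable, so trajectories and \<open>h\<close> are only
  absolutely continuous: both are treated through integral equations, and the derivative described
  above is established only in integrated form. Second, the Riccati right-hand side is quadratic and
  falls outside the Lipschitz theory, so global existence takes a separate argument. That argument
  also delivers positive definiteness, but just for the solution it constructs; uniqueness carries
  it over to the arbitrary \<open>E\<close> of the statement.\<close>

definition volterra_sol ::
  "real \<Rightarrow> (real \<Rightarrow> 'a::euclidean_space) \<Rightarrow> (real \<Rightarrow> 'a \<Rightarrow> 'a) \<Rightarrow> (real \<Rightarrow> 'a) \<Rightarrow> bool" where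
  "volterra_sol T g f X \<longleftrightarrow> continuous_on {0..T} X
     \<and> (\<forall>t\<in>{0..T}. X t = g t + integral {0..t} (\<lambda>s. f s (X s)))"

text \<open>Rough data such as the control or \<zeta> never enter \<open>f\<close>: their primitive
  is put into the free term \<open>g\<close> of the Volterra equation. Hence \<open>f\<close> can be
  asked to preserve continuity of curves.\<close>

locale lipschitz_field =
  fixes T L :: real and f :: "real \<Rightarrow> 'a::euclidean_space \<Rightarrow> 'a"
  assumes T_nonneg: "0 \<le> T"
    and cont: "\<And>x. continuous_on {0..T} x \<Longrightarrow> continuous_on {0..T} (\<lambda>s. f s (x s))"
    and lip: "\<And>s x y. s \<in> {0..T} \<Longrightarrow> norm (f s x - f s y) \<le> L * norm (x - y)"
begin

lemma
  assumes g: "continuous_on {0..T} g"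
  shows volterra_exists: "\<exists>X. volterra_sol T g f X"
    and volterra_unique: "\<lbrakk>volterra_sol T g f X; volterra_sol T g f Y; t \<in> {0..T}\<rbrakk> \<Longrightarrow> X t = Y t"
proof -
  \<comment> \<open>The weight \<open>exp (k * s)\<close> has a primitive smaller by the factor
    \<open>1 / k\<close>, so the Picard map contracts by \<open>L / k\<close>; the choice makes this
    at most 1/2 and keeps \<open>k\<close> positive whatever the sign of \<open>L\<close>.\<close>
  define k where "k = 2 * (\<bar>L\<bar> + 1)"
  have k: "k > 0" and Lk: "L \<le> k / 2" by (auto simp: k_def)
  \<comment> \<open>The complete space for the fixed point theorem is the type of bounded continuous
    functions on the whole line. A curve on \<open>{0..T}\<close> enters it by being frozen at its
    end values outside the interval.\<close>
  define clamp where "clamp t = max 0 (min t T)" for t :: real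
  have clamp_in: "clamp t \<in> {0..T}" for t using T_nonneg by (auto simp: clamp_def)
  have clamp_id: "clamp t = t" if "t \<in> {0..T}" for t using that by (auto simp: clamp_def)
  have clamp_cont: "continuous_on UNIV clamp"
    unfolding clamp_def by (intro continuous_intros)
  define emb where "emb h = Bcontfun (\<lambda>t. h (clamp t))" for h :: "real \<Rightarrow> 'a"
  have emb: "apply_bcontfun (emb h) t = h (clamp t)" if h: "continuous_on {0..T} h" for h t
  proof -
    have "continuous_on UNIV (\<lambda>t. h (clamp t))"
      by (rule continuous_on_compose2[OF h clamp_cont]) (use clamp_in in auto)
    moreover obtain b where "\<And>y. y \<in> h ` {0..T} \<Longrightarrow> norm y \<le> b"
      using compact_imp_bounded[OF compact_continuous_image[OF h compact_Icc]]
      unfolding bounded_iff by auto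
    then have "norm (h (clamp t)) \<le> b" for t using clamp_in by auto
    ultimately have "(\<lambda>t. h (clamp t)) \<in> bcontfun" by (intro bcontfun_normI)
    then show ?thesis by (simp add: emb_def Bcontfun_inverse)
  qed
  \<comment> \<open>In the unknown \<open>exp (- k * t) *\<^sub>R X t\<close> the Picard map contracts by the factor 1/2 on all of \<open>{0..T}\<close>.\<close>
  define V where "V \<phi> t = exp (- k * t) *\<^sub>R (g t + integral {0..t} (\<lambda>s. f s (exp (k * s) *\<^sub>R \<phi> s)))"
    for \<phi> :: "real \<Rightarrow> 'a" and t
  have fc: "continuous_on {0..T} (\<lambda>s. f s (exp (k * s) *\<^sub>R \<phi> s))"
    if "continuous_on {0..T} \<phi>" for \<phi> :: "real \<Rightarrow> 'a"
    by (intro cont continuous_intros that)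
  have Vc: "continuous_on {0..T} (V \<phi>)" if "continuous_on {0..T} \<phi>" for \<phi>
    unfolding V_def
    by (intro continuous_intros g indefinite_integral_continuous_1 integrable_continuous_real fc that)
  have V_contract: "norm (V \<phi> t - V \<psi> t) \<le> (1/2) * D"
    if c: "continuous_on {0..T} \<phi>" "continuous_on {0..T} \<psi>" and t: "t \<in> {0..T}"
      and D: "\<And>s. norm (\<phi> s - \<psi> s) \<le> D" for \<phi> \<psi> :: "real \<Rightarrow> 'a" and t D
  proof -
    let ?F = "\<lambda>\<phi> s. f s (exp (k * s) *\<^sub>R \<phi> s)"
    have sub: "{0..t} \<subseteq> {0..T}" using t by auto
    have i: "?F \<phi> integrable_on {0..t}" "?F \<psi> integrable_on {0..t}"
      using continuous_on_subset[OF fc sub] c by (auto intro: integrable_continuous_real)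
    have D0: "0 \<le> D" using D[of 0] norm_ge_zero order_trans by blast
    have "((\<lambda>s. (k / 2) * (exp (k * s) * D)) has_integral
        (exp (k * t) * D / 2 - exp (k * 0) * D / 2)) {0..t}"
      using t by (intro fundamental_theorem_of_calculus)
        (auto intro!: derivative_eq_intros simp flip: has_real_derivative_iff_has_vector_derivative)
    note bd = this
    have "norm (integral {0..t} (\<lambda>s. ?F \<phi> s - ?F \<psi> s)) \<le>
        integral {0..t} (\<lambda>s. (k / 2) * (exp (k * s) * D))"
    proof (rule integral_norm_bound_integral)
      show "(\<lambda>s. ?F \<phi> s - ?F \<psi> s) integrable_on {0..t}" using i by (intro integrable_diff)
      show "(\<lambda>s. (k / 2) * (exp (k * s) * D)) integrable_on {0..t}" using bd by blast
      fix s assume s: "s \<in> {0..t}"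
      have "norm (?F \<phi> s - ?F \<psi> s) \<le> L * norm (exp (k * s) *\<^sub>R \<phi> s - exp (k * s) *\<^sub>R \<psi> s)"
        using lip s sub by blast
      also have "\<dots> = L * (exp (k * s) * norm (\<phi> s - \<psi> s))"
        by (simp flip: scaleR_diff_right)
      also have "\<dots> \<le> (k / 2) * (exp (k * s) * D)"
        using Lk k D by (intro mult_mono) auto
      finally show "norm (?F \<phi> s - ?F \<psi> s) \<le> (k / 2) * (exp (k * s) * D)" .
    qed
    also have "\<dots> = exp (k * t) * D / 2 - D / 2"
      using integral_unique[OF bd] by simp
    also have "\<dots> \<le> exp (k * t) * D / 2" using D0 by simp
    finally have "exp (- k * t) * norm (integral {0..t} (\<lambda>s. ?F \<phi> s - ?F \<psi> s))
        \<le> exp (- k * t) * (exp (k * t) * D / 2)"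
      by (intro mult_left_mono) auto
    also have "\<dots> = D / 2" by (simp add: exp_minus field_simps)
    finally show ?thesis
      using i by (simp add: V_def integral_diff flip: scaleR_diff_right)
  qed
  define P where "P \<phi> = emb (V (apply_bcontfun \<phi>))" for \<phi>
  have P_app: "apply_bcontfun (P \<phi>) t = V (apply_bcontfun \<phi>) (clamp t)" for \<phi> t
    unfolding P_def by (intro emb Vc continuous_on_apply_bcontfun)
  have "dist (P \<phi>) (P \<psi>) \<le> (1/2) * dist \<phi> \<psi>" for \<phi> \<psi>
    by (rule dist_bound, unfold P_app dist_norm[of "V _ _"], rule V_contract)
      (use clamp_in dist_bounded in \<open>auto simp: dist_norm[symmetric]\<close>)
  then have ex1: "\<exists>!\<phi>. P \<phi> = \<phi>" by (intro banach_fix_type[of "1/2"]) auto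
  show "\<exists>X. volterra_sol T g f X"
  proof -
    obtain \<phi> where \<phi>: "P \<phi> = \<phi>" using ex1 by blast
    define X where "X t = exp (k * t) *\<^sub>R apply_bcontfun \<phi> t" for t
    have "continuous_on {0..T} X" unfolding X_def by (intro continuous_intros) auto
    moreover have "X t = g t + integral {0..t} (\<lambda>s. f s (X s))" if "t \<in> {0..T}" for t
      using P_app[of \<phi> t] \<phi> clamp_id[OF that]
      by (simp add: X_def V_def exp_minus)
    ultimately show ?thesis by (auto simp: volterra_sol_def)
  qed
  show "X t = Y t" if X: "volterra_sol T g f X" and Y: "volterra_sol T g f Y" and t: "t \<in> {0..T}"
  proof -
    \<comment> \<open>Weighting by \<open>exp (- k * t)\<close> turns every solution into a fixed
      point of \<open>P\<close>, and there is just one.\<close>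
    let ?e = "\<lambda>X. emb (\<lambda>t. exp (- k * t) *\<^sub>R X t)"
    have fp: "P (?e X) = ?e X" and app: "apply_bcontfun (?e X) t = exp (- k * t) *\<^sub>R X t"
      if X: "volterra_sol T g f X" for X
    proof -
      have c: "continuous_on {0..T} (\<lambda>t. exp (- k * t) *\<^sub>R X t)"
        using X unfolding volterra_sol_def by (intro continuous_intros) auto
      show "apply_bcontfun (?e X) t = exp (- k * t) *\<^sub>R X t"
        using emb[OF c] clamp_id[OF t] by simp
      show "P (?e X) = ?e X"
      proof (rule bcontfun_eqI)
        fix t
        let ?c = "clamp t"
        have "integral {0..?c} (\<lambda>s. f s (exp (k * s) *\<^sub>R apply_bcontfun (?e X) s))
            = integral {0..?c} (\<lambda>s. f s (X s))"
        proof (rule integral_cong)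
          fix s assume "s \<in> {0..?c}"
          then have "s \<in> {0..T}" using clamp_in[of t] by auto
          then show "f s (exp (k * s) *\<^sub>R apply_bcontfun (?e X) s) = f s (X s)"
            unfolding emb[OF c] by (simp add: clamp_id exp_minus)
        qed
        then show "apply_bcontfun (P (?e X)) t = apply_bcontfun (?e X) t"
          using X clamp_in[of t] unfolding P_app emb[OF c] V_def volterra_sol_def by auto
      qed
    qed
    have "?e X = ?e Y" using ex1 fp[OF X] fp[OF Y] by blast
    then show ?thesis using app[OF X] app[OF Y] by simp
  qed
qed

end

section \<open>Differentiable solutions, time reversal and terminal values\<close>

definition ode_sol :: "real \<Rightarrow> (real \<Rightarrow> 'a::euclidean_space \<Rightarrow> 'a) \<Rightarrow> (real \<Rightarrow> 'a) \<Rightarrow> bool" where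
  "ode_sol T f X \<longleftrightarrow> (\<forall>t\<in>{0..T}. (X has_vector_derivative f t (X t)) (at t within {0..T}))"

lemma ode_sol_continuous: "ode_sol T f X \<Longrightarrow> continuous_on {0..T} X"
  unfolding ode_sol_def
  by (auto simp: continuous_on_eq_continuous_within intro: has_vector_derivative_continuous)

lemma ode_sol_has_integral:
  assumes "ode_sol T f X" "t \<in> {0..T}"
  shows "((\<lambda>s. f s (X s)) has_integral X t - X 0) {0..t}"
proof (rule fundamental_theorem_of_calculus)
  show "(X has_vector_derivative f s (X s)) (at s within {0..t})" if "s \<in> {0..t}" for s
    by (rule has_vector_derivative_within_subset[of _ _ _ "{0..T}"])
      (use assms that in \<open>auto simp: ode_sol_def\<close>)
qed (use assms in simp)

lemma ode_sol_imp_volterra_sol: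
  assumes "ode_sol T f X"
  shows "volterra_sol T (\<lambda>_. X 0) f X"
  using integral_unique[OF ode_sol_has_integral[OF assms]] ode_sol_continuous[OF assms]
  by (simp add: volterra_sol_def)

text \<open>Time reversal exchanges the values at 0 and \<open>T\<close>, which reduces terminal
  value problems to initial value problems; the minus sign is the inner derivative.\<close>

lemma ode_sol_reflect:
  assumes "ode_sol T f X"
  shows "ode_sol T (\<lambda>t x. - f (T - t) x) (\<lambda>t. X (T - t))"
  unfolding ode_sol_def
proof
  fix t assume t: "t \<in> {0..T}"
  have "(X has_vector_derivative f (T - t) (X (T - t))) (at (T - t) within (\<lambda>t. T - t) ` {0..T})"
    using assms t unfolding ode_sol_def by simp
  moreover have "((\<lambda>t. T - t) has_vector_derivative - 1) (at t within {0..T})"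
    by (auto intro!: derivative_eq_intros)
  ultimately show "((\<lambda>t. X (T - t)) has_vector_derivative - f (T - t) (X (T - t))) (at t within {0..T})"
    using vector_diff_chain_within[of "\<lambda>t. T - t" "- 1" t "{0..T}" X] by (simp add: o_def)
qed

context lipschitz_field
begin

lemma volterra_sol_const_imp_ode_sol:
  assumes "volterra_sol T (\<lambda>_. x0) f X"
  shows "ode_sol T f X" "X 0 = x0"
proof -
  have eq: "X t = x0 + integral {0..t} (\<lambda>s. f s (X s))" if "t \<in> {0..T}" for t
    using assms that by (simp add: volterra_sol_def)
  have c: "continuous_on {0..T} (\<lambda>s. f s (X s))"
    using assms by (intro cont) (simp add: volterra_sol_def)
  show "X 0 = x0" using eq[of 0] T_nonneg by simp
  show "ode_sol T f X" unfolding ode_sol_def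
  proof
    fix t assume t: "t \<in> {0..T}"
    have "((\<lambda>t. x0 + integral {0..t} (\<lambda>s. f s (X s))) has_vector_derivative f t (X t))
        (at t within {0..T})"
      using integral_has_vector_derivative[OF c t] by (auto intro!: derivative_eq_intros)
    then show "(X has_vector_derivative f t (X t)) (at t within {0..T})"
      by (rule has_vector_derivative_transform[OF t, rotated]) (use eq in auto)
  qed
qed

lemma initial_value_exists: "\<exists>X. ode_sol T f X \<and> X 0 = x0"
  using volterra_exists[of "\<lambda>_. x0", OF continuous_on_const] volterra_sol_const_imp_ode_sol by blast

lemma initial_value_unique:
  assumes "ode_sol T f X" "ode_sol T f Y" "X 0 = Y 0" "t \<in> {0..T}"
  shows "X t = Y t"
  using volterra_unique[of "\<lambda>_. X 0" X Y t] ode_sol_imp_volterra_sol[OF assms(1)]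
    ode_sol_imp_volterra_sol[OF assms(2)] assms(3,4) by simp

lemma lipschitz_field_reflect: "lipschitz_field T L (\<lambda>t x. - f (T - t) x)"
proof
  show "0 \<le> T" by (rule T_nonneg)
  show "continuous_on {0..T} (\<lambda>s. - f (T - s) (x s))" if x: "continuous_on {0..T} x" for x
  proof -
    \<comment> \<open>\<open>cont\<close> applies to the reversed curve; reversing time once more in
      the result restores \<open>x\<close>.\<close>
    have "continuous_on {0..T} (\<lambda>s. f s (x (T - s)))"
      by (intro cont continuous_on_compose2[OF x] continuous_intros) auto
    then have "continuous_on {0..T} (\<lambda>s. f (T - s) (x (T - (T - s))))"
      by (rule continuous_on_compose2) (auto intro!: continuous_intros)
    then show ?thesis by (auto intro!: continuous_intros)
  qed
  show "norm (- f (T - s) x - - f (T - s) y) \<le> L * norm (x - y)" if "s \<in> {0..T}" for s x y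
    using lip[of "T - s" x y] that by (simp add: norm_minus_commute)
qed

lemma terminal_value_exists: "\<exists>X. ode_sol T f X \<and> X T = x1"
proof -
  interpret r: lipschitz_field T L "\<lambda>t x. - f (T - t) x" by (rule lipschitz_field_reflect)
  obtain Y where Y: "ode_sol T (\<lambda>t x. - f (T - t) x) Y" "Y 0 = x1"
    using r.initial_value_exists by blast
  then show ?thesis using ode_sol_reflect[OF Y(1)] by (intro exI[of _ "\<lambda>t. Y (T - t)"]) simp
qed

lemma terminal_value_unique:
  assumes X: "ode_sol T f X" and Y: "ode_sol T f Y" and "X T = Y T" "t \<in> {0..T}"
  shows "X t = Y t"
proof -
  interpret r: lipschitz_field T L "\<lambda>t x. - f (T - t) x" by (rule lipschitz_field_reflect)
  show ?thesis
    using r.initial_value_unique[OF ode_sol_reflect[OF X] ode_sol_reflect[OF Y], of "T - t"] assms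
    by simp
qed

end

section \<open>Product rule for absolutely continuous functions\<close>

text \<open>Telescoping over an equidistant partition of mesh below \<delta>: the increments of
  \<open>V\<close> add up exactly, those of \<Phi> by the triangle inequality. \<open>V\<close>
  serves as an error budget that may be spent locally.\<close>

lemma norm_diff_le_of_small_increments:
  fixes \<Phi> :: "real \<Rightarrow> 'a::real_normed_vector" and V :: "real \<Rightarrow> real"
  assumes "a \<le> b" and "\<delta> > 0"
    and inc: "\<And>s t. \<lbrakk>a \<le> s; s \<le> t; t \<le> b; t - s < \<delta>\<rbrakk> \<Longrightarrow> norm (\<Phi> t - \<Phi> s) \<le> V t - V s"
  shows "norm (\<Phi> b - \<Phi> a) \<le> V b - V a"
proof -
  obtain n where n: "(b - a) / \<delta> < real n" using reals_Archimedean2 by blast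
  with assms have n0: "n > 0"
    by (metis divide_nonneg_pos diff_ge_0_iff_ge gr0I not_less of_nat_0)
  define p where "p k = a + real k * ((b - a) / n)" for k
  have "(b - a) / n < \<delta>"
    using n n0 \<open>\<delta> > 0\<close> by (simp add: pos_divide_less_eq mult.commute)
  then have step: "p (Suc k) - p k < \<delta>" for k by (simp add: p_def distrib_right add_divide_distrib)
  have "p (Suc k) = p k + (b - a) / n" for k by (simp add: p_def distrib_right add_divide_distrib)
  then have mono: "p k \<le> p (Suc k)" for k using assms by simp
  have pb: "p k \<le> b" if "k \<le> n" for k
  proof -
    have "real k * ((b - a) / n) \<le> real n * ((b - a) / n)"
      using that assms by (intro mult_right_mono) auto
    then show ?thesis using n0 by (simp add: p_def)
  qed
  have pa: "a \<le> p k" for k using assms by (simp add: p_def)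
  have "norm (\<Phi> (p k) - \<Phi> a) \<le> V (p k) - V a" if "k \<le> n" for k
    using that
  proof (induction k)
    case 0
    then show ?case by (simp add: p_def)
  next
    case (Suc k)
    have "norm (\<Phi> (p (Suc k)) - \<Phi> (p k)) \<le> V (p (Suc k)) - V (p k)"
      by (intro inc pa mono pb step Suc.prems)
    then show ?case
      using Suc norm_triangle_ineq[of "\<Phi> (p (Suc k)) - \<Phi> (p k)" "\<Phi> (p k) - \<Phi> a"] by simp
  qed
  from this[of n] show ?thesis using n0 by (simp add: p_def)
qed

lemma absolutely_integrable_bilinear_continuous:
  fixes B :: "'a::euclidean_space \<Rightarrow> 'b::euclidean_space \<Rightarrow> 'c::euclidean_space"
  assumes B: "bounded_bilinear B" and F: "continuous_on {a..b::real} F"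
    and g: "g absolutely_integrable_on {a..b}"
  shows "(\<lambda>s. B (F s) (g s)) absolutely_integrable_on {a..b}"
proof (rule absolutely_integrable_bounded_measurable_product[where h = B and f = F, OF _ _ _ _ g])
  show "bilinear B" using B bilinear_conv_bounded_bilinear by blast
  show "F \<in> borel_measurable (lebesgue_on {a..b})"
    by (rule continuous_imp_measurable_on_sets_lebesgue[OF F]) auto
  show "bounded (F ` {a..b})"
    using compact_imp_bounded[OF compact_continuous_image[OF F compact_Icc]] .
qed auto

text \<open>\<open>F\<close> and \<open>G\<close> are only absolutely continuous, so the
  fundamental theorem of calculus does not apply to \<open>B F G\<close>; instead the increments of
  \<open>B F G\<close> over short intervals are compared with the integral, with error \<open>e * K * \<integral> |f| + |g|\<close>, and
  then summed.\<close>

lemma has_integral_product_rule: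
  fixes B :: "'a::euclidean_space \<Rightarrow> 'b::euclidean_space \<Rightarrow> 'c::euclidean_space"
    and a b :: real
  assumes B: "bounded_bilinear B" and ab: "a \<le> b"
    and f: "f absolutely_integrable_on {a..b}" and g: "g absolutely_integrable_on {a..b}"
    and F: "\<And>t. t \<in> {a..b} \<Longrightarrow> (f has_integral F t - F a) {a..t}"
    and G: "\<And>t. t \<in> {a..b} \<Longrightarrow> (g has_integral G t - G a) {a..t}"
  shows "((\<lambda>s. B (f s) (G s) + B (F s) (g s)) has_integral B (F b) (G b) - B (F a) (G a)) {a..b}"
proof -
  interpret B: bounded_bilinear B by (rule B)
  obtain K where K: "K > 0" "\<And>x y. norm (B x y) \<le> norm x * norm y * K" using B.pos_bounded by blast
  have primitive_cont: "continuous_on {a..b} H"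
    if h: "h absolutely_integrable_on {a..b}"
      and H: "\<And>t. t \<in> {a..b} \<Longrightarrow> (h has_integral H t - H a) {a..t}"
    for h :: "real \<Rightarrow> 'z::euclidean_space" and H
  proof -
    have "continuous_on {a..b} (\<lambda>t. H a + integral {a..t} h)"
      using h by (intro continuous_intros indefinite_integral_continuous_1)
        (auto dest: set_lebesgue_integral_eq_integral)
    then show ?thesis
      by (rule continuous_on_eq) (simp add: integral_unique[OF H])
  qed
  have primitive_diff: "(h has_integral H t - H s) {s..t}"
    if H: "\<And>t. t \<in> {a..b} \<Longrightarrow> (h has_integral H t - H a) {a..t}" and st: "a \<le> s" "s \<le> t" "t \<le> b"
    for h :: "real \<Rightarrow> 'z::euclidean_space" and H s t
  proof -
    have "h integrable_on {s..t}"
      by (rule integrable_subinterval_real[OF has_integral_integrable[OF H[of t]]]) (use st in auto)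
    then show ?thesis
      using has_integral_combine[OF st(1,2) H[of s] integrable_integral[of h "{s..t}"]] H[of t] st
      by (auto simp: algebra_simps has_integral_iff)
  qed
  note Fc = primitive_cont[OF f F] and Gc = primitive_cont[OF g G]
  let ?\<phi> = "\<lambda>s. B (f s) (G s) + B (F s) (g s)"
  have "(\<lambda>s. B (f s) (G s)) absolutely_integrable_on {a..b}"
    using absolutely_integrable_bilinear_continuous[OF B.flip Gc f] .
  then have \<phi>: "?\<phi> integrable_on {a..b}"
    using absolutely_integrable_bilinear_continuous[OF B Fc g]
    by (intro integrable_add) (auto dest: set_lebesgue_integral_eq_integral)
  let ?v = "\<lambda>s. norm (f s) + norm (g s)"
  have v: "?v integrable_on {a..b}"
    using f g by (intro integrable_add) (auto simp: absolutely_integrable_on_def)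
  define \<Phi> where "\<Phi> t = B (F t) (G t) - integral {a..t} ?\<phi>" for t
  have bound: "norm (\<Phi> b - \<Phi> a) \<le> e * K * integral {a..b} ?v" if e: "e > 0" for e
  proof -
    have "uniformly_continuous_on {a..b} F" "uniformly_continuous_on {a..b} G"
      using Fc Gc by (auto intro: compact_uniformly_continuous)
    then obtain d1 d2 where d: "d1 > 0" "d2 > 0"
      "\<And>s t. \<lbrakk>s \<in> {a..b}; t \<in> {a..b}; dist t s < d1\<rbrakk> \<Longrightarrow> dist (F t) (F s) < e"
      "\<And>s t. \<lbrakk>s \<in> {a..b}; t \<in> {a..b}; dist t s < d2\<rbrakk> \<Longrightarrow> dist (G t) (G s) < e"
      using e unfolding uniformly_continuous_on_def by metis
    \<comment> \<open>The subtracted integral is 0; it gives the bound the shape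
      \<open>V b - V a\<close>.\<close>
    have "norm (\<Phi> b - \<Phi> a) \<le> e * K * integral {a..b} ?v - e * K * integral {a..a} ?v"
    proof (rule norm_diff_le_of_small_increments[OF ab, of "min d1 d2"])
      show "min d1 d2 > 0" using d by simp
      fix s t assume st: "a \<le> s" "s \<le> t" "t \<le> b" "t - s < min d1 d2"
      have sub: "?\<phi> integrable_on {s..t}" "?v integrable_on {s..t}"
        using \<phi> v st by (auto intro: integrable_subinterval_real)
      have "((\<lambda>\<tau>. B (f \<tau>) (G t) + B (F s) (g \<tau>)) has_integral
          (B (F t - F s) (G t) + B (F s) (G t - G s))) {s..t}"
        by (intro has_integral_add has_integral_linear[OF _ B.bounded_linear_left, unfolded o_def]
            has_integral_linear[OF _ B.bounded_linear_right, unfolded o_def]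
            primitive_diff[OF F] primitive_diff[OF G] st)
      moreover have "B (F t - F s) (G t) + B (F s) (G t - G s) = B (F t) (G t) - B (F s) (G s)"
        by (simp add: B.diff_left B.diff_right)
      ultimately have D: "((\<lambda>\<tau>. B (f \<tau>) (G t) + B (F s) (g \<tau>) - ?\<phi> \<tau>) has_integral
          B (F t) (G t) - B (F s) (G s) - integral {s..t} ?\<phi>) {s..t}"
        using has_integral_diff[OF _ integrable_integral[OF sub(1)]] by fastforce
      have inc: "integral {a..t} h - integral {a..s} h = integral {s..t} h"
        if "h integrable_on {a..b}" for h :: "real \<Rightarrow> 'z::euclidean_space"
        using Henstock_Kurzweil_Integration.integral_combine[of a s t h]
          integrable_subinterval_real[OF that, of a t] st by (simp add: algebra_simps)
      have "norm (\<Phi> t - \<Phi> s) = norm (integral {s..t} (\<lambda>\<tau>. B (f \<tau>) (G t) + B (F s) (g \<tau>) - ?\<phi> \<tau>))"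
        unfolding \<Phi>_def integral_unique[OF D] inc[OF \<phi>, symmetric]
        by (simp only: algebra_simps)
      also have "\<dots> \<le> integral {s..t} (\<lambda>\<tau>. e * K * ?v \<tau>)"
      proof (rule integral_norm_bound_integral)
        show "(\<lambda>\<tau>. B (f \<tau>) (G t) + B (F s) (g \<tau>) - ?\<phi> \<tau>) integrable_on {s..t}" using D by blast
        show "(\<lambda>\<tau>. e * K * ?v \<tau>) integrable_on {s..t}"
          using sub by (intro integrable_on_mult_right)
        fix \<tau> assume \<tau>: "\<tau> \<in> {s..t}"
        have "B (f \<tau>) (G t) + B (F s) (g \<tau>) - ?\<phi> \<tau> = B (f \<tau>) (G t - G \<tau>) + B (F s - F \<tau>) (g \<tau>)"
          by (simp add: B.diff_left B.diff_right)
        also have "norm \<dots> \<le> norm (f \<tau>) * norm (G t - G \<tau>) * K + norm (F s - F \<tau>) * norm (g \<tau>) * K"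
          by (intro order_trans[OF norm_triangle_ineq] add_mono K)
        also have "\<dots> \<le> norm (f \<tau>) * e * K + e * norm (g \<tau>) * K"
          using d(3)[of \<tau> s] d(4)[of \<tau> t] \<tau> st K(1)
          by (intro add_mono mult_right_mono mult_left_mono) (auto simp: dist_norm norm_minus_commute)
        finally show "norm (B (f \<tau>) (G t) + B (F s) (g \<tau>) - ?\<phi> \<tau>) \<le> e * K * ?v \<tau>"
          by (simp add: algebra_simps)
      qed
      also have "\<dots> = e * K * integral {a..t} ?v - e * K * integral {a..s} ?v"
        using inc[OF v] by (simp flip: right_diff_distrib)
      finally show "norm (\<Phi> t - \<Phi> s) \<le> e * K * integral {a..t} ?v - e * K * integral {a..s} ?v" .
    qed
    then show ?thesis by simp
  qed
  have V0: "0 \<le> integral {a..b} ?v" by (intro integral_nonneg v) auto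
  have "norm (\<Phi> b - \<Phi> a) \<le> 0 + e" if "e > 0" for e
  proof -
    \<comment> \<open>Dividing by \<open>W + 1\<close> instead of \<open>W\<close> covers the case
      \<open>W = 0\<close>.\<close>
    define W where "W = K * integral {a..b} ?v"
    have W: "0 \<le> W" using V0 K by (simp add: W_def)
    have "norm (\<Phi> b - \<Phi> a) \<le> e / (W + 1) * W"
      using bound[of "e / (W + 1)"] that W by (simp add: W_def mult.assoc)
    also have "\<dots> \<le> e" using that W by (simp add: field_simps)
    finally show ?thesis by simp
  qed
  then have "norm (\<Phi> b - \<Phi> a) \<le> 0" by (rule field_le_epsilon)
  then have "integral {a..b} ?\<phi> = B (F b) (G b) - B (F a) (G a)"
    by (simp add: \<Phi>_def algebra_simps)
  then show ?thesis using \<phi> by (metis integrable_integral)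
qed

section \<open>The Riccati equation\<close>

lemma bounded_bilinear_matrix_vector_mult:
  "bounded_bilinear ((*v) :: real^'n^'m \<Rightarrow> real^'n \<Rightarrow> real^'m)"
  unfolding bilinear_conv_bounded_bilinear[symmetric] bilinear_def
  by (auto intro!: linearI simp: algebra_simps scaleR_matrix_vector_assoc)

lemma matrix_mult_scaleR_left: "(c *\<^sub>R A) ** B = c *\<^sub>R (A ** B)"
  for A :: "real^'n^'m" and B :: "real^'k^'n"
  by (simp add: vec_eq_iff matrix_matrix_mult_def sum_distrib_left mult.assoc)

lemma matrix_mult_scaleR_right: "A ** (c *\<^sub>R B) = c *\<^sub>R (A ** B)"
  for A :: "real^'n^'m" and B :: "real^'k^'n"
  by (simp add: vec_eq_iff matrix_matrix_mult_def sum_distrib_left algebra_simps)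

lemma matrix_add_rdistrib_real: "(A + B) ** C = A ** C + B ** C"
  for A B :: "real^'n^'m" and C :: "real^'k^'n"
  by (simp add: vec_eq_iff matrix_matrix_mult_def distrib_right sum.distrib)

lemma bounded_bilinear_matrix_mult:
  "bounded_bilinear ((**) :: real^'n^'m \<Rightarrow> real^'k^'n \<Rightarrow> real^'k^'m)"
  unfolding bilinear_conv_bounded_bilinear[symmetric] bilinear_def
  by (auto intro!: linearI simp: matrix_add_ldistrib matrix_add_rdistrib_real
      matrix_mult_scaleR_left matrix_mult_scaleR_right)

lemma bounded_linear_transpose:
  "bounded_linear (transpose :: real^'n^'m \<Rightarrow> real^'m^'n)"
  unfolding linear_conv_bounded_linear[symmetric]
  by (auto intro!: linearI simp: transpose_def vec_eq_iff)

lemmas continuous_on_matrix_intros =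
  bounded_bilinear.continuous_on[OF bounded_bilinear_matrix_vector_mult]
  bounded_bilinear.continuous_on[OF bounded_bilinear_matrix_mult]
  bounded_linear.continuous_on[OF bounded_linear_transpose]

interpretation mm: bounded_bilinear "(**) :: real^'n^'m \<Rightarrow> real^'k^'n \<Rightarrow> real^'k^'m"
  by (rule bounded_bilinear_matrix_mult)

interpretation mv: bounded_bilinear "(*v) :: real^'n^'m \<Rightarrow> real^'n \<Rightarrow> real^'m"
  by (rule bounded_bilinear_matrix_vector_mult)

lemmas transpose_diff = linear_diff[OF bounded_linear.linear[OF bounded_linear_transpose]]

lemma inner_transpose_matrix_vector: "x \<bullet> (transpose M *v y) = (M *v x) \<bullet> y"
  for M :: "real^'n^'m"
  using dot_lmul_matrix[of y M x] by (simp add: inner_commute)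

lemma matrix_inv_inverse:
  fixes A :: "real^'n^'n"
  assumes "invertible A"
  shows "A ** matrix_inv A = mat 1" "matrix_inv A ** A = mat 1"
  using someI_ex[OF assms[unfolded invertible_def]] by (auto simp: matrix_inv_def)

lemma continuous_on_det:
  fixes Y :: "'a::topological_space \<Rightarrow> real^'n^'n"
  assumes "continuous_on S Y"
  shows "continuous_on S (\<lambda>t. det (Y t))"
  unfolding det_def by (intro continuous_intros assms)

text \<open>By Cramer's rule the entries of the inverse are quotients of determinants, with a
  denominator that does not vanish on \<open>S\<close>.\<close>

lemma continuous_on_matrix_inv:
  fixes Y :: "'a::topological_space \<Rightarrow> real^'n^'n"
  assumes Y: "continuous_on S Y" and inv: "\<And>t. t \<in> S \<Longrightarrow> invertible (Y t)"
  shows "continuous_on S (\<lambda>t. matrix_inv (Y t))"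
proof -
  \<comment> \<open>\<open>M t i j\<close> is \<open>Y t\<close> with column \<open>i\<close>
    replaced by the \<open>j\<close>-th unit vector: the numerator matrix for entry
    \<open>(i, j)\<close> of the inverse.\<close>
  define M where "M t i j = ((\<chi> k l. if l = i then axis j 1 $ k else Y t $ k $ l) :: real^'n^'n)"
    for t and i j :: 'n
  have "continuous_on S (\<lambda>t. M t i j)" for i j
  proof -
    have "continuous_on S (\<lambda>t. if l = i then axis j 1 $ k else Y t $ k $ l)" for k l
      by (cases "l = i") (auto intro!: continuous_intros Y)
    then show ?thesis unfolding M_def by (intro continuous_on_vec_lambda)
  qed
  moreover have "\<forall>t\<in>S. det (Y t) \<noteq> 0" using inv invertible_det_nz by blast
  ultimately have "continuous_on S (\<lambda>t. \<chi> i j. det (M t i j) / det (Y t))"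
    by (intro continuous_on_vec_lambda continuous_on_divide continuous_on_det Y)
  then show ?thesis
  proof (rule continuous_on_eq)
    fix t assume t: "t \<in> S"
    have "Y t *v (matrix_inv (Y t) *v axis j 1) = axis j 1" for j
      by (simp add: matrix_vector_mul_assoc matrix_inv_inverse[OF inv[OF t]])
    then have col: "matrix_inv (Y t) *v axis j 1 = (\<chi> i. det (M t i j) / det (Y t))" for j
      using cramer[of "Y t" "matrix_inv (Y t) *v axis j 1" "axis j 1"] inv[OF t]
      by (simp add: invertible_det_nz M_def)
    have "matrix_inv (Y t) $ i $ j = (matrix_inv (Y t) *v axis j 1) $ i" for i j
      by (simp add: matrix_vector_mult_basis column_def)
    then show "(\<chi> i j. det (M t i j) / det (Y t)) = matrix_inv (Y t)"
      by (simp add: vec_eq_iff col)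
  qed
qed

text \<open>The normalised remainder in the definition and the difference quotient minus
  \<open>D\<close> differ only by the sign of \<open>s - t\<close>, so their norms agree. The
  quotient form suits the inverse matrix, where exact algebra is available before the limit.\<close>

lemma has_vector_derivative_iff_tendsto_quotient:
  "(f has_vector_derivative D) (at t within S)
    \<longleftrightarrow> ((\<lambda>s. (1 / (s - t)) *\<^sub>R (f s - f t)) \<longlongrightarrow> D) (at t within S)"
proof -
  let ?q = "\<lambda>s. (1 / norm (s - t)) *\<^sub>R (f s - (f t + (s - t) *\<^sub>R D))"
  let ?r = "\<lambda>s. (1 / (s - t)) *\<^sub>R (f s - f t) - D"
  have "norm (?q s) = norm (?r s)" if "s \<noteq> t" for s
  proof -
    have "?r s = (1 / (s - t)) *\<^sub>R (f s - (f t + (s - t) *\<^sub>R D))"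
      using that by (simp add: scaleR_add_right scaleR_diff_right)
    then show ?thesis by simp
  qed
  then have "\<forall>\<^sub>F s in at t within S. norm (?q s) = norm (?r s)"
    by (auto simp: eventually_at_filter)
  then have "((\<lambda>s. norm (?q s)) \<longlongrightarrow> 0) (at t within S) \<longleftrightarrow> ((\<lambda>s. norm (?r s)) \<longlongrightarrow> 0) (at t within S)"
    by (rule tendsto_cong)
  then show ?thesis
    unfolding has_vector_derivative_def has_derivative_within tendsto_norm_zero_iff LIM_zero_iff
    by (simp add: bounded_linear_scaleR_left)
qed

text \<open>With \<open>W\<close> the inverse of \<open>Y\<close>, the identity
  \<open>W s ** (Y s - Y t) ** W t = W t - W s\<close> is exact. Hence the difference quotient of
  \<open>W\<close> is minus that of \<open>Y\<close> between two inverses, and continuity of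
  \<open>W\<close> gives the limit.\<close>

lemma has_vector_derivative_matrix_inv:
  fixes Y :: "real \<Rightarrow> real^'n^'n"
  assumes Y: "continuous_on S Y" and inv: "\<And>t. t \<in> S \<Longrightarrow> invertible (Y t)" and t: "t \<in> S"
    and Y': "(Y has_vector_derivative Y') (at t within S)"
  shows "((\<lambda>t. matrix_inv (Y t)) has_vector_derivative
      - (matrix_inv (Y t) ** Y' ** matrix_inv (Y t))) (at t within S)"
proof -
  let ?W = "\<lambda>t. matrix_inv (Y t)"
  have "((\<lambda>s. - (?W s ** ((1 / (s - t)) *\<^sub>R (Y s - Y t)) ** ?W t)) \<longlongrightarrow> - (?W t ** Y' ** ?W t)) (at t within S)"
  proof (intro tendsto_minus mm.tendsto tendsto_const)
    show "(?W \<longlongrightarrow> ?W t) (at t within S)"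
      using continuous_on_matrix_inv[OF Y inv] t by (simp add: continuous_on_def)
    show "((\<lambda>s. (1 / (s - t)) *\<^sub>R (Y s - Y t)) \<longlongrightarrow> Y') (at t within S)"
      using Y' by (simp add: has_vector_derivative_iff_tendsto_quotient)
  qed
  moreover have "- (?W s ** ((1 / (s - t)) *\<^sub>R (Y s - Y t)) ** ?W t) = (1 / (s - t)) *\<^sub>R (?W s - ?W t)"
    if "s \<in> S" for s
  proof -
    have "?W s ** (Y s - Y t) ** ?W t = ?W t - ?W s"
      by (simp add: mm.diff_left mm.diff_right matrix_mul_assoc[symmetric]
          matrix_inv_inverse[OF inv[OF t]])
        (simp add: matrix_mul_assoc matrix_inv_inverse[OF inv[OF that]])
    then show ?thesis
      by (simp add: mm.scaleR_left mm.scaleR_right flip: scaleR_minus_right)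
  qed
  ultimately have "((\<lambda>s. (1 / (s - t)) *\<^sub>R (?W s - ?W t)) \<longlongrightarrow> - (?W t ** Y' ** ?W t)) (at t within S)"
    by (rule Lim_transform_within[OF _ zero_less_one])
  then show ?thesis by (simp add: has_vector_derivative_iff_tendsto_quotient)
qed

text \<open>A linear map is determined by its values on the finite basis. Each of these values is
  continuous in \<open>s\<close>, hence bounded on the compact interval, and the sum of the bounds
  is a Lipschitz constant uniform in \<open>s\<close>.\<close>

lemma lipschitz_field_affine:
  fixes f :: "real \<Rightarrow> 'a::euclidean_space \<Rightarrow> 'a"
  assumes T: "0 \<le> T" and lin: "\<And>s. linear (f s)"
    and f: "\<And>x. continuous_on {0..T} (\<lambda>s. f s x)" and b: "continuous_on {0..T} b"
  obtains L where "lipschitz_field T L (\<lambda>s x. f s x + b s)"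
proof -
  have rep: "f s x = (\<Sum>i\<in>Basis. (x \<bullet> i) *\<^sub>R f s i)" for s x
  proof -
    have "f s x = f s (\<Sum>i\<in>Basis. (x \<bullet> i) *\<^sub>R i)" by (simp add: euclidean_representation)
    also have "\<dots> = (\<Sum>i\<in>Basis. (x \<bullet> i) *\<^sub>R f s i)"
      by (simp add: linear_sum[OF lin] linear_scale[OF lin])
    finally show ?thesis .
  qed
  have "\<exists>K. \<forall>s\<in>{0..T}. norm (f s i) \<le> K" for i
    using compact_imp_bounded[OF compact_continuous_image[OF f[of i] compact_Icc]]
    unfolding bounded_iff by auto
  then obtain K where K: "\<And>i s. s \<in> {0..T} \<Longrightarrow> norm (f s i) \<le> K i" by metis
  have "lipschitz_field T (\<Sum>i\<in>Basis. K i) (\<lambda>s x. f s x + b s)"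
  proof
    show "continuous_on {0..T} (\<lambda>s. f s (x s) + b s)" if "continuous_on {0..T} x" for x
      by (subst rep) (intro continuous_intros that f b)
    fix s x y assume s: "s \<in> {0..T}"
    have "norm (f s x + b s - (f s y + b s)) = norm (f s (x - y))"
      by (simp add: linear_diff[OF lin])
    also have "\<dots> \<le> (\<Sum>i\<in>Basis. norm (((x - y) \<bullet> i) *\<^sub>R f s i))"
      by (subst rep) (rule norm_sum)
    also have "\<dots> \<le> (\<Sum>i\<in>Basis. norm (x - y) * K i)"
      by (intro sum_mono) (auto intro!: mult_mono K s Basis_le_norm)
    finally show "norm (f s x + b s - (f s y + b s)) \<le> (\<Sum>i\<in>Basis. K i) * norm (x - y)"
      by (simp add: sum_distrib_right mult.commute)
  qed (rule T)
  then show ?thesis by (rule that)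
qed

section \<open>Uniqueness, symmetry and global existence for the Riccati equation\<close>

context
  fixes T :: real and C :: "real^'d^'e" and Q :: "real^'d^'d" and A :: "real \<Rightarrow> real^'d^'d"
    and lam :: real
  assumes T: "0 \<le> T" and A: "continuous_on {0..T} A"
begin

lemma riccati_sol_continuous: "riccati_sol T C Q A lam E \<Longrightarrow> continuous_on {0..T} E"
  unfolding riccati_sol_def
  by (auto simp: continuous_on_eq_continuous_within intro: has_vector_derivative_continuous)

text \<open>The difference \<open>D\<close> of two solutions satisfies a linear equation with zero
  initial value, since \<open>E ** E - F ** F = E ** D + D ** F\<close>. The Lipschitz theory thus
  applies although the Riccati field itself is quadratic.\<close>

lemma riccati_sol_unique:
  assumes E: "riccati_sol T C Q A lam E" and F: "riccati_sol T C Q A lam F" and t: "t \<in> {0..T}"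
  shows "E t = F t"
proof -
  note cont = A riccati_sol_continuous[OF E] riccati_sol_continuous[OF F]
  let ?f = "\<lambda>s D. - (transpose (A s) ** D) - D ** A s - (1/lam) *\<^sub>R (E s ** D + D ** F s)"
  obtain L where "lipschitz_field T L (\<lambda>s D. ?f s D + 0)"
  proof (rule lipschitz_field_affine[OF T, of ?f "\<lambda>_. 0"])
    show "linear (?f s)" for s
      by (rule linearI) (auto simp: mm.add_left mm.add_right mm.scaleR_left mm.scaleR_right algebra_simps)
    show "continuous_on {0..T} (\<lambda>s. ?f s D)" for D
      by (intro continuous_intros continuous_on_matrix_intros cont)
  qed auto
  then interpret lipschitz_field T L ?f by simp
  have "ode_sol T ?f (\<lambda>s. E s - F s)" unfolding ode_sol_def
  proof
    fix s assume "s \<in> {0..T}"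
    then have "((\<lambda>s. E s - F s) has_vector_derivative
        (transpose C ** C - transpose (A s) ** E s - E s ** A s - (1/lam) *\<^sub>R (E s ** E s))
        - (transpose C ** C - transpose (A s) ** F s - F s ** A s - (1/lam) *\<^sub>R (F s ** F s)))
        (at s within {0..T})"
      using E F unfolding riccati_sol_def by (intro has_vector_derivative_diff) auto
    then show "((\<lambda>s. E s - F s) has_vector_derivative ?f s (E s - F s)) (at s within {0..T})"
      by (rule has_vector_derivative_eq_rhs) (simp add: mm.diff_left mm.diff_right algebra_simps)
  qed
  moreover have "ode_sol T ?f (\<lambda>s. 0)"
    by (simp add: ode_sol_def mm.zero_left mm.zero_right)
  ultimately have "E t - F t = 0"
    using E F by (intro initial_value_unique[OF _ _ _ t, of "\<lambda>s. E s - F s" "\<lambda>s. 0"])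
      (auto simp: riccati_sol_def)
  then show ?thesis by simp
qed

text \<open>Transposing the equation swaps its two terms in \<open>A\<close> and fixes the rest, so
  the transpose solves the same initial value problem and uniqueness applies.\<close>

lemma riccati_sol_symmetric:
  assumes E: "riccati_sol T C Q A lam E" and Q: "transpose Q = Q" and t: "t \<in> {0..T}"
  shows "transpose (E t) = E t"
proof -
  have "riccati_sol T C Q A lam (\<lambda>t. transpose (E t))" unfolding riccati_sol_def
  proof (intro conjI ballI)
    show "transpose (E 0) = Q" using E Q by (simp add: riccati_sol_def)
    fix s assume "s \<in> {0..T}"
    then have "((\<lambda>s. transpose (E s)) has_vector_derivative
        transpose (transpose C ** C - transpose (A s) ** E s - E s ** A s - (1/lam) *\<^sub>R (E s ** E s)))
        (at s within {0..T})"
      using E unfolding riccati_sol_def by (intro bounded_linear.has_vector_derivative[OF bounded_linear_transpose]) auto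
    then show "((\<lambda>s. transpose (E s)) has_vector_derivative
        transpose C ** C - transpose (A s) ** transpose (E s) - transpose (E s) ** A s
        - (1/lam) *\<^sub>R (transpose (E s) ** transpose (E s))) (at s within {0..T})"
      by (rule has_vector_derivative_eq_rhs) (simp add: transpose_diff transpose_scalar matrix_transpose_mul)
  qed
  from riccati_sol_unique[OF this E t] show ?thesis .
qed

text \<open>Linearisation: with \<open>Y' = A Y + Z / lam\<close>, \<open>Z' = C\<^sup>T C Y - A\<^sup>T Z\<close>, \<open>Y 0 = I\<close>, \<open>Z 0 = Q\<close> the
  quotient \<open>Z Y\<^sup>-\<^sup>1\<close> solves the Riccati equation. Since
  \<open>(Y v \<bullet> Z v)' = |Z v|\<^sup>2 / lam + |C Y v|\<^sup>2 \<ge> 0\<close>, the matrix \<open>Y\<close> stays invertible, so the solution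
  does not blow up.\<close>

lemma riccati_sol_exists_pos:
  assumes lam: "lam > 0" and Q: "\<And>x. x \<noteq> 0 \<Longrightarrow> x \<bullet> (Q *v x) > 0"
  obtains E where "riccati_sol T C Q A lam E"
    and "\<And>t x. \<lbrakk>t \<in> {0..T}; x \<noteq> 0\<rbrakk> \<Longrightarrow> x \<bullet> (E t *v x) > 0"
proof -
  let ?f = "\<lambda>s (w :: (real^'d^'d) \<times> (real^'d^'d)). (A s ** fst w + (1/lam) *\<^sub>R snd w,
    transpose C ** C ** fst w - transpose (A s) ** snd w)"
  obtain L where "lipschitz_field T L (\<lambda>s w. ?f s w + 0)"
  proof (rule lipschitz_field_affine[OF T, of ?f "\<lambda>_. 0"])
    show "linear (?f s)" for s
      by (rule linearI) (auto simp: mm.add_right mm.scaleR_right algebra_simps)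
    show "continuous_on {0..T} (\<lambda>s. ?f s w)" for w
      by (intro continuous_intros continuous_on_matrix_intros A)
  qed auto
  then interpret lipschitz_field T L ?f by simp
  obtain W where W: "ode_sol T ?f W" "W 0 = (mat 1, Q)" using initial_value_exists by blast
  define Y where "Y = (\<lambda>t. fst (W t))"
  define Z where "Z = (\<lambda>t. snd (W t))"
  have YZ0: "Y 0 = mat 1" "Z 0 = Q" using W by (auto simp: Y_def Z_def)
  have Y': "(Y has_vector_derivative A t ** Y t + (1/lam) *\<^sub>R Z t) (at t within {0..T})"
    and Z': "(Z has_vector_derivative transpose C ** C ** Y t - transpose (A t) ** Z t) (at t within {0..T})"
    if "t \<in> {0..T}" for t
  proof -
    have "(W has_vector_derivative ?f t (W t)) (at t within {0..T})"
      using W that by (simp add: ode_sol_def)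
    from bounded_linear.has_vector_derivative[OF bounded_linear_fst this]
      bounded_linear.has_vector_derivative[OF bounded_linear_snd this]
    show "(Y has_vector_derivative A t ** Y t + (1/lam) *\<^sub>R Z t) (at t within {0..T})"
      "(Z has_vector_derivative transpose C ** C ** Y t - transpose (A t) ** Z t) (at t within {0..T})"
      by (simp_all add: Y_def Z_def)
  qed
  have pairing: "v \<bullet> (Q *v v) \<le> (Y t *v v) \<bullet> (Z t *v v)" if t: "t \<in> {0..T}" for t v
  proof -
    let ?p' = "\<lambda>s. (1/lam) * (norm (Z s *v v))\<^sup>2 + (norm (C *v (Y s *v v)))\<^sup>2"
    have "(?p' has_integral (Y t *v v) \<bullet> (Z t *v v) - (Y 0 *v v) \<bullet> (Z 0 *v v)) {0..t}"
    proof (rule fundamental_theorem_of_calculus)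
      fix s assume s: "s \<in> {0..t}"
      then have s': "s \<in> {0..T}" using t by auto
      have "((\<lambda>s. (Y s *v v) \<bullet> (Z s *v v)) has_vector_derivative
          (Y s *v v) \<bullet> ((transpose C ** C ** Y s - transpose (A s) ** Z s) *v v)
          + ((A s ** Y s + (1/lam) *\<^sub>R Z s) *v v) \<bullet> (Z s *v v)) (at s within {0..T})"
        by (intro bounded_bilinear.has_vector_derivative[OF bounded_bilinear_inner]
            bounded_linear.has_vector_derivative[OF mv.bounded_linear_left] Y' Z' s')
      moreover have "(Y s *v v) \<bullet> ((transpose C ** C ** Y s - transpose (A s) ** Z s) *v v)
          + ((A s ** Y s + (1/lam) *\<^sub>R Z s) *v v) \<bullet> (Z s *v v) = ?p' s"
        by (simp add: mv.add_left mv.diff_left mv.scaleR_left inner_add_left inner_diff_right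
            inner_scaleR_left matrix_vector_mul_assoc[symmetric] inner_transpose_matrix_vector
            power2_norm_eq_inner del: transpose_matrix_vector)
      ultimately show "((\<lambda>s. (Y s *v v) \<bullet> (Z s *v v)) has_vector_derivative ?p' s) (at s within {0..t})"
        using t by (auto intro: has_vector_derivative_within_subset)
    qed (use t in auto)
    then have "0 \<le> (Y t *v v) \<bullet> (Z t *v v) - (Y 0 *v v) \<bullet> (Z 0 *v v)"
      by (rule has_integral_nonneg) (use lam in auto)
    then show ?thesis by (simp add: YZ0)
  qed
  have Yinv: "invertible (Y t)" if t: "t \<in> {0..T}" for t
  proof -
    have "v = 0" if "Y t *v v = 0" for v
      using pairing[OF t, of v] Q[of v] that by (cases "v = 0") auto
    then obtain B where "B ** Y t = mat 1" using matrix_left_invertible_ker by metis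
    then show ?thesis unfolding invertible_def using matrix_left_right_inverse by metis
  qed
  have Yc: "continuous_on {0..T} Y"
    unfolding continuous_on_eq_continuous_within
    using has_vector_derivative_continuous[OF Y'] by blast
  define E where "E t = Z t ** matrix_inv (Y t)" for t
  show ?thesis
  proof
    show "riccati_sol T C Q A lam E" unfolding riccati_sol_def
    proof (intro conjI ballI)
      have "matrix_inv (mat 1 :: real^'d^'d) = mat 1"
        using matrix_inv_inverse[of "mat 1 :: real^'d^'d"] by (simp add: invertible_def)
      then show "E 0 = Q" by (simp add: E_def YZ0)
      fix t assume t: "t \<in> {0..T}"
      note inv = matrix_inv_inverse[OF Yinv[OF t]]
      have "(E has_vector_derivative
          Z t ** (- (matrix_inv (Y t) ** (A t ** Y t + (1/lam) *\<^sub>R Z t) ** matrix_inv (Y t)))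
          + (transpose C ** C ** Y t - transpose (A t) ** Z t) ** matrix_inv (Y t)) (at t within {0..T})"
        unfolding E_def
        by (intro mm.has_vector_derivative has_vector_derivative_matrix_inv Y' Z' t Yc Yinv)
      then show "(E has_vector_derivative
          transpose C ** C - transpose (A t) ** E t - E t ** A t - (1/lam) *\<^sub>R (E t ** E t))
          (at t within {0..T})"
        by (rule has_vector_derivative_eq_rhs)
          (simp add: E_def mm.add_left mm.add_right mm.diff_left mm.diff_right mm.minus_right mm.scaleR_left
            mm.scaleR_right matrix_mul_assoc[symmetric] inv)
    qed
    fix t and x :: "real^'d" assume t: "t \<in> {0..T}" and x: "x \<noteq> 0"
    \<comment> \<open>Substituting \<open>x = Y t *v v\<close> turns the form of \<open>E t\<close>
      at \<open>x\<close> into the pairing of \<open>Y t *v v\<close> and \<open>Z t *v v\<close>,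
      which dominates the form of \<open>Q\<close> at \<open>v\<close>.\<close>
    define v where "v = matrix_inv (Y t) *v x"
    have "Y t *v v = x"
      by (simp add: v_def matrix_vector_mul_assoc matrix_inv_inverse[OF Yinv[OF t]])
    moreover from this x have "v \<noteq> 0" by auto
    moreover have "Z t *v v = E t *v x" by (simp add: v_def E_def matrix_vector_mul_assoc)
    ultimately show "x \<bullet> (E t *v x) > 0" using pairing[OF t, of v] Q[of v] by simp
  qed
qed

end

section \<open>Controls and trajectories\<close>

lemma set_integrable_lborel_imp_absolutely_integrable:
  "set_integrable lborel S f \<Longrightarrow> f absolutely_integrable_on S"
  unfolding set_integrable_def by (subst integrable_completion) auto

lemma L2_on_absolutely_integrable:
  assumes "L2_on T u"
  shows "u absolutely_integrable_on {0..T}"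
    and "(\<lambda>t. (norm (u t))\<^sup>2) absolutely_integrable_on {0..T}"
proof -
  have sq: "set_integrable lborel {0..T} (\<lambda>t. (norm (u t))\<^sup>2)"
    and m: "set_borel_measurable lborel {0..T} u"
    using assms by (auto simp: L2_on_def)
  show "(\<lambda>t. (norm (u t))\<^sup>2) absolutely_integrable_on {0..T}"
    by (rule set_integrable_lborel_imp_absolutely_integrable[OF sq])
  \<comment> \<open>An integrable majorant of \<open>norm (u t)\<close>, because the interval has
    finite length; the domination follows from
    \<open>(norm (u t) - 1/2)\<^sup>2 \<ge> 0\<close>.\<close>
  have "set_integrable lborel {0..T} (\<lambda>t. 1 + (norm (u t))\<^sup>2)"
    by (intro set_integral_add sq borel_integrable_atLeastAtMost' continuous_intros)
  then have "set_integrable lborel {0..T} u"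
  proof (rule set_integrable_bound[OF _ m])
    have "norm (u t) \<le> norm (1 + (norm (u t))\<^sup>2)" for t
      using zero_le_power2[of "norm (u t) - 1/2"] by (simp add: power2_eq_square algebra_simps)
    then show "AE t in lborel. t \<in> {0..T} \<longrightarrow> norm (u t) \<le> norm (1 + (norm (u t))\<^sup>2)" by simp
  qed
  then show "u absolutely_integrable_on {0..T}"
    by (rule set_integrable_lborel_imp_absolutely_integrable)
qed

lemma Linf_on_imp_L2_on:
  assumes "Linf_on T z"
  shows "L2_on T z"
  unfolding L2_on_def
proof
  obtain B where m: "set_borel_measurable lborel {0..T} z"
    and B: "AE t in lborel. t \<in> {0..T} \<longrightarrow> norm (z t) \<le> B"
    using assms by (auto simp: Linf_on_def)
  show "set_borel_measurable lborel {0..T} z" by (rule m)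
  have "set_integrable lborel {0..T} (\<lambda>_. B\<^sup>2)"
    by (intro borel_integrable_atLeastAtMost' continuous_intros)
  then show "set_integrable lborel {0..T} (\<lambda>t. (norm (z t))\<^sup>2)"
  proof (rule set_integrable_bound)
    have "(\<lambda>t. (norm (indicator {0..T} t *\<^sub>R z t))\<^sup>2) \<in> borel_measurable lborel"
      using m unfolding set_borel_measurable_def by measurable
    also have "(\<lambda>t. (norm (indicator {0..T} t *\<^sub>R z t))\<^sup>2) = (\<lambda>t. indicator {0..T} t *\<^sub>R (norm (z t))\<^sup>2)"
      by (auto simp: indicator_def)
    finally show "set_borel_measurable lborel {0..T} (\<lambda>t. (norm (z t))\<^sup>2)"
      by (simp add: set_borel_measurable_def)
    show "AE t in lborel. t \<in> {0..T} \<longrightarrow> norm ((norm (z t))\<^sup>2) \<le> norm (B\<^sup>2)"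
      using B by eventually_elim (auto intro: power_mono)
  qed
qed

lemma continuous_on_imp_L2_on:
  assumes "continuous_on {0..T} u"
  shows "L2_on T u"
  unfolding L2_on_def
proof
  show "set_borel_measurable lborel {0..T} u"
    using borel_integrable_atLeastAtMost'[OF assms]
    unfolding set_integrable_def set_borel_measurable_def by (rule borel_measurable_integrable)
  show "set_integrable lborel {0..T} (\<lambda>t. (norm (u t))\<^sup>2)"
    by (intro borel_integrable_atLeastAtMost' continuous_intros assms)
qed

text \<open>Serves both the misfit of \<zeta> against \<open>C *v X\<close> and the distance of a
  control from the feedback law. In the expanded square the cross term is a continuous function
  against an integrable one.\<close>

lemma L2_on_diff_continuous_integrable:
  assumes u: "L2_on T u" and v: "continuous_on {0..T} v"
  shows "(\<lambda>t. (norm (u t - v t))\<^sup>2) integrable_on {0..T}"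
proof -
  have "(\<lambda>t. (norm (u t))\<^sup>2) integrable_on {0..T}" "(\<lambda>t. v t \<bullet> u t) integrable_on {0..T}"
    using L2_on_absolutely_integrable[OF u]
      absolutely_integrable_bilinear_continuous[OF bounded_bilinear_inner v]
    by (auto dest: set_lebesgue_integral_eq_integral(1))
  moreover have "(\<lambda>t. (norm (v t))\<^sup>2) integrable_on {0..T}"
    by (intro integrable_continuous_real continuous_intros v)
  ultimately have "(\<lambda>t. (norm (u t))\<^sup>2 - 2 * (v t \<bullet> u t) + (norm (v t))\<^sup>2) integrable_on {0..T}"
    by (intro integrable_add integrable_diff integrable_on_mult_right)
  also have "(\<lambda>t. (norm (u t))\<^sup>2 - 2 * (v t \<bullet> u t) + (norm (v t))\<^sup>2) = (\<lambda>t. (norm (u t - v t))\<^sup>2)"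
    by (auto simp: power2_norm_eq_inner inner_diff_left inner_diff_right inner_commute)
  finally show ?thesis .
qed

text \<open>Converts a vanishing squared distance from the feedback law into equality almost
  everywhere. The detour through \<open>lebesgue\<close> is harmless since completion preserves
  almost-everywhere statements.\<close>

lemma integral_nonneg_eq_0_imp_AE:
  fixes f :: "'a::euclidean_space \<Rightarrow> real"
  assumes f: "f integrable_on S" and nonneg: "\<And>x. x \<in> S \<Longrightarrow> 0 \<le> f x" and "integral S f = 0"
  shows "AE x in lborel. x \<in> S \<longrightarrow> f x = 0"
proof -
  have ai: "f absolutely_integrable_on S"
    using f nonneg by (rule nonnegative_absolutely_integrable_1)
  have "integral\<^sup>L lebesgue (\<lambda>x. indicator S x *\<^sub>R f x) = 0"
    using set_lebesgue_integral_eq_integral(2)[OF ai] assms(3)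
    by (simp add: set_lebesgue_integral_def)
  moreover have "AE x in lebesgue. 0 \<le> indicator S x *\<^sub>R f x"
    using nonneg by (auto simp: indicator_def)
  ultimately have "AE x in lebesgue. indicator S x *\<^sub>R f x = 0"
    using integral_nonneg_eq_0_iff_AE ai[unfolded set_integrable_def] by blast
  then have "AE x in lborel. indicator S x *\<^sub>R f x = 0" by (simp only: AE_completion_iff)
  then show ?thesis by eventually_elim (auto simp: indicator_def)
qed

section \<open>Trajectories of the perturbed linear equation\<close>

context
  fixes T :: real and A :: "real \<Rightarrow> real^'d^'d" and r :: "real \<Rightarrow> real^'d"
  assumes T: "0 < T" and A: "continuous_on {0..T} A" and r: "continuous_on {0..T} r"
begin

text \<open>\<open>is_ode_sol\<close> does not mention continuity; it follows because
  \<open>X\<close> is an indefinite integral. Then \<open>A s *v X s\<close> is continuous, and its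
  integral can be separated from that of \<open>r s + u s\<close>.\<close>

lemma is_ode_sol_iff_volterra_sol:
  assumes u: "u integrable_on {0..T}"
  shows "is_ode_sol T A r x0 u X
    \<longleftrightarrow> volterra_sol T (\<lambda>t. x0 + integral {0..t} (\<lambda>s. r s + u s)) (\<lambda>s x. A s *v x) X"
proof -
  have ru: "(\<lambda>s. r s + u s) integrable_on {0..T}"
    using u integrable_continuous_real[OF r] by (intro integrable_add)
  have rut: "(\<lambda>s. r s + u s) integrable_on {0..t}" if "t \<in> {0..T}" for t
    by (rule integrable_subinterval_real[OF ru]) (use that in auto)
  have AX: "(\<lambda>s. A s *v X s) integrable_on {0..t}"
    if "continuous_on {0..T} X" "t \<in> {0..T}" for t
    by (rule integrable_continuous_real, rule continuous_on_subset[of "{0..T}"],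
        intro continuous_on_matrix_intros A that) (use that in auto)
  have split: "((\<lambda>s. A s *v X s + r s + u s) has_integral X t - x0) {0..t}
      \<longleftrightarrow> X t = x0 + integral {0..t} (\<lambda>s. r s + u s) + integral {0..t} (\<lambda>s. A s *v X s)"
    if X: "continuous_on {0..T} X" and t: "t \<in> {0..T}" for t
  proof -
    have "((\<lambda>s. A s *v X s + r s + u s) has_integral
        integral {0..t} (\<lambda>s. A s *v X s) + integral {0..t} (\<lambda>s. r s + u s)) {0..t}"
      using has_integral_add[OF integrable_integral[OF AX[OF X t]] integrable_integral[OF rut[OF t]]]
      by (simp add: add.assoc)
    then show ?thesis by (auto simp: has_integral_iff algebra_simps)
  qed
  have "continuous_on {0..T} X" if "is_ode_sol T A r x0 u X"
  proof -
    let ?w = "\<lambda>s. A s *v X s + r s + u s"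
    have w: "(?w has_integral X t - x0) {0..t}" if "t \<in> {0..T}" for t
      using \<open>is_ode_sol T A r x0 u X\<close> that by (auto simp: is_ode_sol_def)
    have "?w integrable_on {0..T}" using w[of T] T by auto
    then have "continuous_on {0..T} (\<lambda>t. x0 + integral {0..t} ?w)"
      by (intro continuous_intros indefinite_integral_continuous_1)
    then show ?thesis
      by (rule continuous_on_eq) (simp add: integral_unique[OF w])
  qed
  then show ?thesis using split by (auto simp: is_ode_sol_def volterra_sol_def)
qed

lemma linear_field:
  obtains L where "lipschitz_field T L (\<lambda>s x. A s *v x)"
proof (rule lipschitz_field_affine[of T "\<lambda>s x. A s *v x" "\<lambda>_. 0"])
  show "continuous_on {0..T} (\<lambda>s. A s *v x)" for x
    by (intro continuous_intros continuous_on_matrix_intros A)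
qed (use T that in auto)

lemma
  assumes u: "u integrable_on {0..T}"
  shows is_ode_sol_traj: "is_ode_sol T A r x0 u (traj T A r x0 u)"
    and traj_eq: "\<lbrakk>is_ode_sol T A r x0 u X; t \<in> {0..T}\<rbrakk> \<Longrightarrow> traj T A r x0 u t = X t"
proof -
  let ?g = "\<lambda>t. x0 + integral {0..t} (\<lambda>s. r s + u s)"
  obtain L where "lipschitz_field T L (\<lambda>s x. A s *v x)" using linear_field .
  then interpret lipschitz_field T L "\<lambda>s x. A s *v x" .
  note iff = is_ode_sol_iff_volterra_sol[OF u]
  have g: "continuous_on {0..T} ?g"
    using u integrable_continuous_real[OF r]
    by (intro continuous_intros indefinite_integral_continuous_1 integrable_add)
  have unique: "X t = Y t" if "is_ode_sol T A r x0 u X" "is_ode_sol T A r x0 u Y" "t \<in> {0..T}" for X Y t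
    using volterra_unique[OF g] that iff by blast
  obtain X where X: "is_ode_sol T A r x0 u X" using volterra_exists[OF g] iff by blast
  \<comment> \<open>The definite description in \<open>traj\<close> ranges over functions on the
    whole line, while the equation determines values on \<open>{0..T}\<close> only; the value 0
    elsewhere makes the function unique.\<close>
  have cut: "is_ode_sol T A r x0 u (\<lambda>t. if t \<in> {0..T} then X t else 0)"
    unfolding is_ode_sol_def
  proof
    fix t assume t: "t \<in> {0..T}"
    have "((\<lambda>s. A s *v (if s \<in> {0..T} then X s else 0) + r s + u s) has_integral X t - x0) {0..t}"
      by (rule has_integral_eq[of "{0..t}" "\<lambda>s. A s *v X s + r s + u s"])
        (use X t in \<open>auto simp: is_ode_sol_def\<close>)
    then show "((\<lambda>s. A s *v (if s \<in> {0..T} then X s else 0) + r s + u s) has_integral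
        (if t \<in> {0..T} then X t else 0) - x0) {0..t}"
      using t by simp
  qed
  have "\<exists>!X. is_ode_sol T A r x0 u X \<and> (\<forall>t. t \<notin> {0..T} \<longrightarrow> X t = 0)"
  proof (rule ex1I)
    show "is_ode_sol T A r x0 u (\<lambda>t. if t \<in> {0..T} then X t else 0)
        \<and> (\<forall>t. t \<notin> {0..T} \<longrightarrow> (if t \<in> {0..T} then X t else 0) = 0)"
      using cut by simp
    fix Y assume Y: "is_ode_sol T A r x0 u Y \<and> (\<forall>t. t \<notin> {0..T} \<longrightarrow> Y t = 0)"
    show "Y = (\<lambda>t. if t \<in> {0..T} then X t else 0)"
      using Y unique[OF _ X, of Y] by fastforce
  qed
  from theI'[OF this] show *: "is_ode_sol T A r x0 u (traj T A r x0 u)"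
    unfolding traj_def by blast
  show "traj T A r x0 u t = X t" if "is_ode_sol T A r x0 u X" "t \<in> {0..T}" for X
    using unique[OF *] that by blast
qed

end

section \<open>The optimal control\<close>

text \<open>The closed form itself, with no infimum in it; \<open>optimal_control\<close> shows that
  it is the attained minimum.\<close>

definition profiled_cost ::
  "real \<Rightarrow> (real \<Rightarrow> real^'d) \<Rightarrow> real \<Rightarrow> (real \<Rightarrow> real^'e) \<Rightarrow> (real \<Rightarrow> real^'d^'d)
    \<Rightarrow> (real \<Rightarrow> real^'d) \<Rightarrow> real" where
  "profiled_cost T r lam z E h =
     integral {0..T} (\<lambda>t. (norm (z t))\<^sup>2 - 2 * (r t \<bullet> h t) - (1/lam) * (norm (h t))\<^sup>2)
     - h T \<bullet> (matrix_inv (E T) *v h T)"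

text \<open>With \<open>a = A x\<close>, \<open>p = E x\<close> and \<open>c = C x\<close> the left-hand side is the derivative of
  \<open>x \<bullet> E x + 2 h \<bullet> x\<close> along a trajectory.\<close>

lemma completion_of_square:
  fixes a p q x r u h :: "'a::real_inner" and z c :: "'b::real_inner"
  assumes "lam \<noteq> 0"
  shows "(a + r + u) \<bullet> p + (c \<bullet> c - a \<bullet> p - p \<bullet> a - (1/lam) * (p \<bullet> p) + p \<bullet> (a + r + u))
      + 2 * (- (h \<bullet> a + (1/lam) * (h \<bullet> p) + (z \<bullet> c + r \<bullet> p)) + h \<bullet> (a + r + u))
    = (norm (z - c))\<^sup>2 + lam * (norm u)\<^sup>2
      - ((norm z)\<^sup>2 - 2 * (r \<bullet> h) - (1/lam) * (norm h)\<^sup>2)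
      - lam * (norm (u - (1/lam) *\<^sub>R (p + h)))\<^sup>2"
proof -
  have "lam * (norm (u - (1/lam) *\<^sub>R (p + h)))\<^sup>2
      = lam * (u \<bullet> u) - 2 * (u \<bullet> p + u \<bullet> h) + (1/lam) * (p \<bullet> p + 2 * (h \<bullet> p) + h \<bullet> h)"
    using assms
    by (simp add: power2_norm_eq_inner inner_diff_left inner_diff_right inner_add_left inner_add_right
        inner_commute field_simps)
  then show ?thesis
    by (simp add: power2_norm_eq_inner inner_diff_left inner_diff_right inner_add_left
        inner_add_right inner_commute algebra_simps)
qed

lemma symmetric_inner:
  fixes M :: "real^'n^'n"
  assumes "transpose M = M"
  shows "(M *v x) \<bullet> y = x \<bullet> (M *v y)"
  using inner_transpose_matrix_vector[of x M y] assms by simp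

text \<open>\<open>e\<close> is the stationary point, \<open>M *v e = - b\<close>, so centring at
  \<open>e\<close> absorbs the linear term. For \<open>E T\<close> and \<open>h T\<close> it is the
  optimal final state.\<close>

lemma quadratic_completion:
  fixes M :: "real^'n^'n" and b :: "real^'n"
  assumes M: "transpose M = M" and inv: "invertible M"
  defines "e \<equiv> - (matrix_inv M *v b)"
  shows "x \<bullet> (M *v x) + 2 * (b \<bullet> x) = (x - e) \<bullet> (M *v (x - e)) - b \<bullet> (matrix_inv M *v b)"
proof -
  have "M *v (matrix_inv M *v b) = b"
    by (simp add: matrix_vector_mul_assoc matrix_inv_inverse[OF inv])
  then have Me: "M *v e = - b" by (simp add: e_def mv.minus_right)
  have "e \<bullet> (M *v x) = - (b \<bullet> x)"
    using symmetric_inner[OF M, of e x] by (simp add: Me)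
  moreover have "e \<bullet> (M *v e) = b \<bullet> (matrix_inv M *v b)"
    by (simp add: Me) (simp add: e_def inner_commute)
  moreover have "x \<bullet> (M *v e) = - (b \<bullet> x)" by (simp add: Me inner_commute)
  ultimately show ?thesis by (simp add: mv.diff_right inner_diff_left inner_diff_right)
qed

section \<open>The linear equation for \<open>h\<close>, the cost identity and the minimiser\<close>

context
  fixes T lam :: real and C :: "real^'d^'e" and Q :: "real^'d^'d"
    and A :: "real \<Rightarrow> real^'d^'d" and r :: "real \<Rightarrow> real^'d" and z :: "real \<Rightarrow> real^'e"
  assumes T: "0 < T" and A: "continuous_on {0..T} A" and r: "continuous_on {0..T} r"
    and z: "L2_on T z" and lam: "lam > 0" and Qsym: "transpose Q = Q"
begin

lemma h_sol_forcing_absolutely_integrable: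
  assumes E: "continuous_on {0..T} E"
  shows "(\<lambda>s. transpose C *v z s + E s *v r s) absolutely_integrable_on {0..T}"
proof (rule set_integral_add)
  show "(\<lambda>s. transpose C *v z s) absolutely_integrable_on {0..T}"
    by (rule absolutely_integrable_bilinear_continuous[OF bounded_bilinear_matrix_vector_mult
          continuous_on_const L2_on_absolutely_integrable(1)[OF z]])
  show "(\<lambda>s. E s *v r s) absolutely_integrable_on {0..T}"
    by (intro absolutely_integrable_continuous_real continuous_on_matrix_intros E r)
qed

lemma h_sol_exists:
  assumes E: "continuous_on {0..T} E"
  shows "\<exists>h. h_sol T C A r lam z E h"
proof -
  let ?b = "\<lambda>s. transpose C *v z s + E s *v r s"
  let ?f = "\<lambda>s h. - ((transpose (A s) + (1/lam) *\<^sub>R E s) *v h)"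
  obtain L where "lipschitz_field T L (\<lambda>s h. ?f s h + 0)"
  proof (rule lipschitz_field_affine[of T ?f "\<lambda>_. 0"])
    show "linear (?f s)" for s
      by (rule linearI) (simp_all add: mv.add_right mv.scaleR_right)
    show "continuous_on {0..T} (\<lambda>s. ?f s h)" for h
      by (intro continuous_intros continuous_on_matrix_intros A E)
  qed (use T in auto)
  then interpret lipschitz_field T L ?f by simp
  have b: "?b integrable_on {0..T}"
    using h_sol_forcing_absolutely_integrable[OF E] by (rule set_lebesgue_integral_eq_integral)
  \<comment> \<open>The forcing is only integrable, but its primitive is continuous and can act as
    the free term; the remaining field is linear with continuous coefficients.\<close>
  obtain h where h: "volterra_sol T (\<lambda>t. - integral {0..t} ?b) ?f h"
    using volterra_exists indefinite_integral_continuous_1[OF b, THEN continuous_on_minus] by blast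
  have "h_sol T C A r lam z E h" unfolding h_sol_def
  proof
    fix t assume t: "t \<in> {0..T}"
    have "continuous_on {0..T} (\<lambda>s. ?f s (h s))"
      using h by (intro cont) (simp add: volterra_sol_def)
    then have "(\<lambda>s. ?f s (h s)) integrable_on {0..t}"
      using t by (intro integrable_continuous_real) (auto elim: continuous_on_subset)
    moreover have "?b integrable_on {0..t}"
      by (rule integrable_subinterval_real[OF b]) (use t in auto)
    ultimately have "((\<lambda>s. ?f s (h s) - ?b s) has_integral
        integral {0..t} (\<lambda>s. ?f s (h s)) - integral {0..t} ?b) {0..t}"
      by (intro has_integral_diff integrable_integral)
    moreover have "h t = integral {0..t} (\<lambda>s. ?f s (h s)) - integral {0..t} ?b"
      using h t unfolding volterra_sol_def by (subst diff_conv_add_uminus, subst add.commute) blast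
    moreover have "- (a + b) = - a - b" for a b :: "real^'d" by simp
    ultimately show "((\<lambda>s. - ((transpose (A s) + (1/lam) *\<^sub>R E s) *v h s + ?b s)) has_integral h t) {0..t}"
      by (simp only:)
  qed
  then show ?thesis by (rule exI[of _ h])
qed

context
  fixes E :: "real \<Rightarrow> real^'d^'d" and h :: "real \<Rightarrow> real^'d"
  assumes E: "riccati_sol T C Q A lam E" and h: "h_sol T C A r lam z E h"
begin

lemma E_continuous: "continuous_on {0..T} E"
  using riccati_sol_continuous[OF _ A E] T by simp

lemma E_symmetric: "t \<in> {0..T} \<Longrightarrow> transpose (E t) = E t"
  using riccati_sol_symmetric[OF _ A E Qsym] T by simp

lemma h_continuous: "continuous_on {0..T} h"
proof -
  let ?w = "\<lambda>s. - ((transpose (A s) + (1/lam) *\<^sub>R E s) *v h s + (transpose C *v z s + E s *v r s))"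
  have w: "(?w has_integral h t) {0..t}" if "t \<in> {0..T}" for t
    using h that unfolding h_sol_def by blast
  have "?w integrable_on {0..T}" using w[of T] T by auto
  then have "continuous_on {0..T} (\<lambda>t. integral {0..t} ?w)"
    by (rule indefinite_integral_continuous_1)
  then show ?thesis by (rule continuous_on_eq) (rule integral_unique[OF w])
qed

text \<open>The form in \<open>X\<close>, \<open>E\<close>, \<open>X\<close> is trilinear while the
  product rule is bilinear. The rule is therefore used for \<open>E *v X\<close>, then for the inner
  product of \<open>X\<close> with it, and a third time for \<open>h \<bullet> X\<close>; the
  integrands are matched pointwise by \<open>completion_of_square\<close>.\<close>

lemma lyapunov_identity:
  assumes u: "L2_on T u" and X: "is_ode_sol T A r x0 u X"
  shows "((\<lambda>t. (norm (z t - C *v X t))\<^sup>2 + lam * (norm (u t))\<^sup>2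
      - ((norm (z t))\<^sup>2 - 2 * (r t \<bullet> h t) - (1/lam) * (norm (h t))\<^sup>2)
      - lam * (norm (u t - (1/lam) *\<^sub>R (E t *v X t + h t)))\<^sup>2)
    has_integral X T \<bullet> (E T *v X T) + 2 * (h T \<bullet> X T) - x0 \<bullet> (Q *v x0)) {0..T}"
proof -
  note u1 = L2_on_absolutely_integrable(1)[OF u]
  have "volterra_sol T (\<lambda>t. x0 + integral {0..t} (\<lambda>s. r s + u s)) (\<lambda>s x. A s *v x) X"
    using is_ode_sol_iff_volterra_sol[OF T A r] X u1 set_lebesgue_integral_eq_integral(1) by blast
  then have Xc: "continuous_on {0..T} X" by (simp add: volterra_sol_def)
  define w where "w s = A s *v X s + r s + u s" for s
  define e where "e s = transpose C ** C - transpose (A s) ** E s - E s ** A s - (1/lam) *\<^sub>R (E s ** E s)"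
    for s
  define k where "k s = - ((transpose (A s) + (1/lam) *\<^sub>R E s) *v h s + (transpose C *v z s + E s *v r s))"
    for s
  have wai: "w absolutely_integrable_on {0..T}" unfolding w_def
    by (intro set_integral_add u1 absolutely_integrable_continuous_real continuous_on_matrix_intros
        A Xc r)
  have ec: "continuous_on {0..T} e" unfolding e_def
    by (intro continuous_intros continuous_on_matrix_intros E_continuous A)
  have kai: "k absolutely_integrable_on {0..T}"
  proof -
    have "(\<lambda>s. - ((transpose (A s) + (1/lam) *\<^sub>R E s) *v h s)) absolutely_integrable_on {0..T}"
      by (intro absolutely_integrable_continuous_real continuous_intros continuous_on_matrix_intros
          E_continuous A h_continuous)
    note set_integral_diff(1)[OF this h_sol_forcing_absolutely_integrable[OF E_continuous]]
    moreover have "- (a + b) = - a - b" for a b :: "real^'d" by simp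
    ultimately show ?thesis unfolding k_def by (simp only:)
  qed
  \<comment> \<open>The initial condition is hidden in the integral equation at
    \<open>t = 0\<close>, where the integral over a single point vanishes; the same is done for
    \<open>h\<close> below.\<close>
  have "(w has_integral X 0 - x0) {0..0}"
    using X T unfolding is_ode_sol_def w_def by (meson atLeastAtMost_iff less_imp_le order_refl)
  then have "X 0 - x0 = 0" by (intro has_integral_unique[OF _ has_integral_refl(2)[of w 0]]) simp
  then have X0: "X 0 = x0" by simp
  have wX: "(w has_integral X t - X 0) {0..t}" if "t \<in> {0..T}" for t
    using X that unfolding is_ode_sol_def w_def X0 by blast
  have "(k has_integral h 0) {0..0}"
    using h T unfolding h_sol_def k_def by (meson atLeastAtMost_iff less_imp_le order_refl)
  then have h0: "h 0 = 0" by (intro has_integral_unique[OF _ has_integral_refl(2)[of k 0]]) simp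
  have kh: "(k has_integral h t - h 0) {0..t}" if "t \<in> {0..T}" for t
    using h that unfolding h_sol_def k_def h0 by simp
  have eE: "(e has_integral E t - E 0) {0..t}" if t: "t \<in> {0..T}" for t
  proof (rule fundamental_theorem_of_calculus)
    show "(E has_vector_derivative e s) (at s within {0..t})" if "s \<in> {0..t}" for s
      by (rule has_vector_derivative_within_subset[of _ _ _ "{0..T}"])
        (use E that t in \<open>auto simp: riccati_sol_def e_def\<close>)
  qed (use t in simp)
  have eai: "e absolutely_integrable_on {0..T}"
    by (rule absolutely_integrable_continuous_real[OF ec])
  define p where "p s = e s *v X s + E s *v w s" for s
  have pai: "p absolutely_integrable_on {0..T}" unfolding p_def
    by (intro set_integral_add absolutely_integrable_continuous_real continuous_on_matrix_intros ec Xc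
        absolutely_integrable_bilinear_continuous[OF bounded_bilinear_matrix_vector_mult E_continuous wai])
  have pEX: "(p has_integral E t *v X t - E 0 *v X 0) {0..t}" if t: "t \<in> {0..T}" for t
    unfolding p_def
    by (rule has_integral_product_rule[OF bounded_bilinear_matrix_vector_mult])
      (use t in \<open>auto intro: eE wX absolutely_integrable_on_subinterval[OF eai]
        absolutely_integrable_on_subinterval[OF wai]\<close>)
  have "((\<lambda>s. w s \<bullet> (E s *v X s) + X s \<bullet> p s) has_integral
      X T \<bullet> (E T *v X T) - X 0 \<bullet> (E 0 *v X 0)) {0..T}"
    by (rule has_integral_product_rule[OF bounded_bilinear_inner _ wai pai wX pEX]) (use T in auto)
  moreover have "((\<lambda>s. k s \<bullet> X s + h s \<bullet> w s) has_integral h T \<bullet> X T - h 0 \<bullet> X 0) {0..T}"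
    by (rule has_integral_product_rule[OF bounded_bilinear_inner _ kai wai kh wX]) (use T in auto)
  ultimately have "((\<lambda>s. (w s \<bullet> (E s *v X s) + X s \<bullet> p s) + 2 * (k s \<bullet> X s + h s \<bullet> w s)) has_integral
      (X T \<bullet> (E T *v X T) - X 0 \<bullet> (E 0 *v X 0)) + 2 * (h T \<bullet> X T - h 0 \<bullet> X 0)) {0..T}"
    by (intro has_integral_add has_integral_mult_right)
  moreover have "(X T \<bullet> (E T *v X T) - X 0 \<bullet> (E 0 *v X 0)) + 2 * (h T \<bullet> X T - h 0 \<bullet> X 0)
      = X T \<bullet> (E T *v X T) + 2 * (h T \<bullet> X T) - x0 \<bullet> (Q *v x0)"
    using E by (simp add: riccati_sol_def X0 h0)
  ultimately have "((\<lambda>s. (w s \<bullet> (E s *v X s) + X s \<bullet> p s) + 2 * (k s \<bullet> X s + h s \<bullet> w s)) has_integral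
      X T \<bullet> (E T *v X T) + 2 * (h T \<bullet> X T) - x0 \<bullet> (Q *v x0)) {0..T}" by (simp only:)
  then show ?thesis
  proof (rule has_integral_eq[rotated])
    fix s assume s: "s \<in> {0..T}"
    \<comment> \<open>Symmetry of \<open>E s\<close> and the adjoint rule move every matrix off the
      left factor \<open>X s\<close>, leaving inner products of \<open>A X\<close>,
      \<open>E X\<close> and \<open>C X\<close> only.\<close>
    note sym = symmetric_inner[OF E_symmetric[OF s]]
    have "X s \<bullet> (transpose (A s) *v (E s *v X s)) = (A s *v X s) \<bullet> (E s *v X s)"
      "X s \<bullet> (transpose C *v (C *v X s)) = (C *v X s) \<bullet> (C *v X s)"
      by (rule inner_transpose_matrix_vector)+
    then have "X s \<bullet> (e s *v X s) = (C *v X s) \<bullet> (C *v X s) - (A s *v X s) \<bullet> (E s *v X s)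
        - (E s *v X s) \<bullet> (A s *v X s) - (1/lam) * ((E s *v X s) \<bullet> (E s *v X s))"
      by (simp add: e_def mv.diff_left mv.scaleR_left inner_diff_right sym
          matrix_vector_mul_assoc[symmetric] del: transpose_matrix_vector)
    moreover have "X s \<bullet> (E s *v w s) = (E s *v X s) \<bullet> w s" by (simp add: sym)
    moreover have "k s \<bullet> X s = - (h s \<bullet> (A s *v X s) + (1/lam) * (h s \<bullet> (E s *v X s))
        + (z s \<bullet> (C *v X s) + r s \<bullet> (E s *v X s)))"
      by (simp add: k_def mv.add_left mv.scaleR_left inner_add_left inner_diff_left sym dot_lmul_matrix)
    ultimately show "(w s \<bullet> (E s *v X s) + X s \<bullet> p s) + 2 * (k s \<bullet> X s + h s \<bullet> w s)
      = (norm (z s - C *v X s))\<^sup>2 + lam * (norm (u s))\<^sup>2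
      - ((norm (z s))\<^sup>2 - 2 * (r s \<bullet> h s) - (1/lam) * (norm (h s))\<^sup>2)
      - lam * (norm (u s - (1/lam) *\<^sub>R (E s *v X s + h s)))\<^sup>2"
      using completion_of_square[of lam "A s *v X s" "r s" "u s" "E s *v X s" "C *v X s" "h s" "z s"] lam
      by (simp only: p_def w_def inner_add_right[of "X s"])
  qed
qed

text \<open>Being an identity for every admissible pair, not just an estimate, it yields the lower
  bound, its attainment and the equality case together. Separate integrability of the three groups
  of terms is what allows the integral to be split.\<close>

lemma cost_eq:
  fixes x0 :: "real^'d"
  assumes u: "L2_on T u" and inv: "invertible (E T)"
  defines "X \<equiv> traj T A r x0 u" and "e \<equiv> - (matrix_inv (E T) *v h T)"
  shows "cost T C Q A r lam z u x0 = profiled_cost T r lam z E h + (X T - e) \<bullet> (E T *v (X T - e))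
    + lam * integral {0..T} (\<lambda>t. (norm (u t - (1/lam) *\<^sub>R (E t *v X t + h t)))\<^sup>2)"
    and "continuous_on {0..T} X"
proof -
  have ui: "u integrable_on {0..T}"
    using L2_on_absolutely_integrable(1)[OF u] by (rule set_lebesgue_integral_eq_integral)
  have X: "is_ode_sol T A r x0 u X" unfolding X_def by (rule is_ode_sol_traj[OF T A r ui])
  then show Xc: "continuous_on {0..T} X"
    using is_ode_sol_iff_volterra_sol[OF T A r ui] by (simp add: volterra_sol_def)
  let ?c = "\<lambda>t. (norm (z t - C *v X t))\<^sup>2 + lam * (norm (u t))\<^sup>2"
  let ?k = "\<lambda>t. (norm (z t))\<^sup>2 - 2 * (r t \<bullet> h t) - (1/lam) * (norm (h t))\<^sup>2"
  let ?d = "\<lambda>t. (norm (u t - (1/lam) *\<^sub>R (E t *v X t + h t)))\<^sup>2"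
  have sq: "(\<lambda>t. (norm (v t))\<^sup>2) integrable_on {0..T}"
    if "L2_on T v" for v :: "real \<Rightarrow> 'z::euclidean_space"
    using L2_on_absolutely_integrable(2)[OF that] by (rule set_lebesgue_integral_eq_integral)
  have c: "?c integrable_on {0..T}"
    by (intro integrable_add integrable_on_mult_right sq[OF u] L2_on_diff_continuous_integrable[OF z]
        continuous_on_matrix_intros continuous_on_const Xc)
  have k: "?k integrable_on {0..T}"
    by (intro integrable_diff integrable_on_mult_right sq[OF z] integrable_continuous_real
        continuous_intros r h_continuous)
  have d: "(\<lambda>t. lam * ?d t) integrable_on {0..T}"
    by (intro integrable_on_mult_right L2_on_diff_continuous_integrable[OF u] continuous_intros
        continuous_on_matrix_intros E_continuous Xc h_continuous)
  have "integral {0..T} (\<lambda>t. ?c t - ?k t - lam * ?d t)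
      = integral {0..T} ?c - integral {0..T} ?k - lam * integral {0..T} ?d"
    by (simp only: integral_diff[OF integrable_diff[OF c k] d] integral_diff[OF c k] integral_mult_right)
  then have "integral {0..T} ?c - integral {0..T} ?k - lam * integral {0..T} ?d
      = X T \<bullet> (E T *v X T) + 2 * (h T \<bullet> X T) - x0 \<bullet> (Q *v x0)"
    using integral_unique[OF lyapunov_identity[OF u X]] by simp
  moreover have "transpose (E T) = E T" using E_symmetric T by simp
  note quadratic_completion[OF this inv, of "X T" "h T"]
  ultimately show "cost T C Q A r lam z u x0 = profiled_cost T r lam z E h + (X T - e) \<bullet> (E T *v (X T - e))
    + lam * integral {0..T} ?d"
    by (simp add: cost_def profiled_cost_def e_def X_def)
qed

text \<open>\<open>E\<close> is an arbitrary Riccati solution here, so positivity at time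
  \<open>T\<close> is assumed; it makes \<open>E T\<close> invertible and the terminal term vanish
  only at \<open>X T = e\<close>.\<close>

lemma optimal_control:
  assumes pos: "\<And>x. x \<noteq> 0 \<Longrightarrow> x \<bullet> (E T *v x) > 0"
  defines "S \<equiv> profiled_cost T r lam z E h"
  shows "invertible (E T)"
    and "\<exists>ubar xhat. L2_on T ubar
      \<and> cost T C Q A r lam z ubar xhat = S
      \<and> (\<forall>u x0. L2_on T u \<longrightarrow> S \<le> cost T C Q A r lam z u x0)
      \<and> (\<forall>u x0. L2_on T u \<and> cost T C Q A r lam z u x0 = S
            \<longrightarrow> x0 = xhat \<and> (AE t in lborel. t \<in> {0..T} \<longrightarrow> u t = ubar t))
      \<and> (\<forall>t\<in>{0..T}. ubar t = (1/lam) *\<^sub>R (E t *v traj T A r xhat ubar t + h t))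
      \<and> traj T A r xhat ubar T = - (matrix_inv (E T) *v h T)"
proof -
  define e where "e = - (matrix_inv (E T) *v h T)"
  have "x = 0" if "E T *v x = 0" for x using pos[of x] that by (cases "x = 0") auto
  then obtain B where "B ** E T = mat 1" using matrix_left_invertible_ker by metis
  then show inv: "invertible (E T)"
    unfolding invertible_def using matrix_left_right_inverse by metis
  note cost = cost_eq[OF _ inv, folded e_def S_def]
  define fb where "fb X t = (1/lam) *\<^sub>R (E t *v X t + h t)" for X t
  \<comment> \<open>The closed-loop field, with linear and state-free parts separated as
    \<open>lipschitz_field_affine\<close> expects; \<open>f_eq\<close> regroups it as drift plus
    feedback.\<close>
  let ?f = "\<lambda>s x. (A s *v x + (1/lam) *\<^sub>R (E s *v x)) + (r s + (1/lam) *\<^sub>R h s)"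
  have f_eq: "?f s (X s) = A s *v X s + r s + fb X s" for X s
    by (simp add: fb_def algebra_simps)
  obtain L where "lipschitz_field T L ?f"
  proof (rule lipschitz_field_affine[of T "\<lambda>s x. A s *v x + (1/lam) *\<^sub>R (E s *v x)"
        "\<lambda>s. r s + (1/lam) *\<^sub>R h s"])
    show "linear (\<lambda>x. A s *v x + (1/lam) *\<^sub>R (E s *v x))" for s
      by (rule linearI) (simp_all add: mv.add_right mv.scaleR_right algebra_simps)
    show "continuous_on {0..T} (\<lambda>s. A s *v x + (1/lam) *\<^sub>R (E s *v x))" for x
      by (intro continuous_intros continuous_on_matrix_intros A E_continuous)
    show "continuous_on {0..T} (\<lambda>s. r s + (1/lam) *\<^sub>R h s)"
      by (intro continuous_intros r h_continuous)
  qed (use T in auto)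
  then interpret lipschitz_field T L ?f .
  \<comment> \<open>The optimal initial state is not prescribed: it is read off as
    \<open>y 0\<close> after solving backwards from \<open>e\<close>.\<close>
  obtain y where y: "ode_sol T ?f y" "y T = e" using terminal_value_exists by blast
  define ubar where "ubar = fb y"
  have yc: "continuous_on {0..T} y" by (rule ode_sol_continuous[OF y(1)])
  have fbc: "continuous_on {0..T} (fb X)" if "continuous_on {0..T} X" for X
    unfolding fb_def
    by (intro continuous_intros continuous_on_matrix_intros E_continuous h_continuous that)
  have L2: "L2_on T ubar"
    unfolding ubar_def by (intro continuous_on_imp_L2_on fbc yc)
  have "is_ode_sol T A r (y 0) ubar y"
    unfolding is_ode_sol_def ubar_def f_eq[symmetric] using ode_sol_has_integral[OF y(1)] by blast
  then have traj: "traj T A r (y 0) ubar t = y t" if "t \<in> {0..T}" for t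
    using traj_eq[OF T A r integrable_continuous_real[OF fbc[OF yc], folded ubar_def]] that by blast
  have nonneg: "(x - e) \<bullet> (E T *v (x - e)) \<ge> 0" for x
    using pos[of "x - e"] by (cases "x = e") auto
  let ?d = "\<lambda>u X t. (norm (u t - (1/lam) *\<^sub>R (E t *v X t + h t)))\<^sup>2"
  have di: "?d u X integrable_on {0..T}" if "L2_on T u" "continuous_on {0..T} X" for u X
    using L2_on_diff_continuous_integrable[OF that(1) fbc[OF that(2)]] by (simp add: fb_def)
  have d0: "0 \<le> integral {0..T} (?d u X)" if "L2_on T u" "continuous_on {0..T} X" for u X
    by (intro integral_nonneg di that) auto
  show "\<exists>ubar xhat. L2_on T ubar
      \<and> cost T C Q A r lam z ubar xhat = S
      \<and> (\<forall>u x0. L2_on T u \<longrightarrow> S \<le> cost T C Q A r lam z u x0)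
      \<and> (\<forall>u x0. L2_on T u \<and> cost T C Q A r lam z u x0 = S
            \<longrightarrow> x0 = xhat \<and> (AE t in lborel. t \<in> {0..T} \<longrightarrow> u t = ubar t))
      \<and> (\<forall>t\<in>{0..T}. ubar t = (1/lam) *\<^sub>R (E t *v traj T A r xhat ubar t + h t))
      \<and> traj T A r xhat ubar T = - (matrix_inv (E T) *v h T)"
  proof (intro exI[of _ ubar] exI[of _ "y 0"] conjI allI impI ballI)
    show "L2_on T ubar" by (rule L2)
    show "traj T A r (y 0) ubar T = - (matrix_inv (E T) *v h T)"
      using traj T y by (simp add: e_def)
    show "ubar t = (1/lam) *\<^sub>R (E t *v traj T A r (y 0) ubar t + h t)" if "t \<in> {0..T}" for t
      unfolding traj[OF that] by (simp add: ubar_def fb_def)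
    have "integral {0..T} (?d ubar (traj T A r (y 0) ubar)) = integral {0..T} (\<lambda>_. 0)"
      by (rule integral_cong) (simp add: traj, simp add: ubar_def fb_def)
    then show "cost T C Q A r lam z ubar (y 0) = S"
      using cost(1)[OF L2, of "y 0"] traj[of T] T y(2) by simp
    show "S \<le> cost T C Q A r lam z u x0" if "L2_on T u" for u x0
      using cost[OF that, of x0] nonneg d0[OF that cost(2)[OF that]] lam by simp
    fix u x0 assume "L2_on T u \<and> cost T C Q A r lam z u x0 = S"
    then have u: "L2_on T u" and min: "cost T C Q A r lam z u x0 = S" by auto
    define X where "X = traj T A r x0 u"
    have Xc: "continuous_on {0..T} X" unfolding X_def by (rule cost(2)[OF u])
    have "(X T - e) \<bullet> (E T *v (X T - e)) + lam * integral {0..T} (?d u X) = 0"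
      using cost(1)[OF u, of x0] min by (simp add: X_def)
    moreover have "0 \<le> lam * integral {0..T} (?d u X)" using d0[OF u Xc] lam by simp
    ultimately have "(X T - e) \<bullet> (E T *v (X T - e)) = 0" and "lam * integral {0..T} (?d u X) = 0"
      using nonneg[of "X T"] by linarith+
    then have XT: "X T = e" and d: "integral {0..T} (?d u X) = 0"
      using pos[of "X T - e"] lam by (cases "X T = e"; auto)+
    from integral_nonneg_eq_0_imp_AE[OF di[OF u Xc] _ d]
    have ae: "AE t in lborel. t \<in> {0..T} \<longrightarrow> u t = fb X t" by (simp add: fb_def)
    have "is_ode_sol T A r x0 u X" unfolding X_def
      using L2_on_absolutely_integrable(1)[OF u]
      by (intro is_ode_sol_traj[OF T A r] set_lebesgue_integral_eq_integral(1))
    then have "((\<lambda>s. A s *v X s + r s + u s) has_integral X t - x0) {0..t}" if "t \<in> {0..T}" for t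
      using that by (simp add: is_ode_sol_def)
    \<comment> \<open>The control agrees with the feedback only almost everywhere, but integrals
      ignore null sets, so \<open>X\<close> satisfies the closed-loop integral equation at every
      \<open>t\<close>. Its integrand is continuous, so \<open>X\<close> is differentiable and
      backward uniqueness identifies it with \<open>y\<close>.\<close>
    moreover have "((\<lambda>s. A s *v X s + r s + u s) has_integral X t - x0) {0..t}
        \<longleftrightarrow> ((\<lambda>s. ?f s (X s)) has_integral X t - x0) {0..t}" if "t \<in> {0..T}" for t
      unfolding f_eq
      by (rule has_integral_AE) (use ae that in \<open>auto elim!: eventually_mono\<close>)
    ultimately have f_int: "((\<lambda>s. ?f s (X s)) has_integral X t - x0) {0..t}" if "t \<in> {0..T}" for t
      using that by blast
    have "volterra_sol T (\<lambda>_. x0) ?f X"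
      using Xc integral_unique[OF f_int] by (simp add: volterra_sol_def)
    note X_ode = volterra_sol_const_imp_ode_sol[OF this]
    have Xy: "X t = y t" if "t \<in> {0..T}" for t
      by (rule terminal_value_unique[OF X_ode(1) y(1) _ that]) (simp add: XT y(2))
    show "x0 = y 0" using Xy[of 0] X_ode(2) T by simp
    show "AE t in lborel. t \<in> {0..T} \<longrightarrow> u t = ubar t"
      using ae by eventually_elim (simp add: Xy ubar_def fb_def)
  qed
qed

end

end

theorem mainTheorem1:
  fixes T :: real and C :: "real^'d^'e" and Q :: "real^'d^'d"
    and \<Theta> :: "(real^'p) set" and \<theta> :: "real^'p"
    and A :: "real^'p \<Rightarrow> real \<Rightarrow> real^'d^'d" and r :: "real^'p \<Rightarrow> real \<Rightarrow> real^'d"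
    and \<zeta> :: "real \<Rightarrow> real^'e" and lam :: real
  assumes "T > 0"
    and "\<And>th. th \<in> \<Theta> \<Longrightarrow> continuous_on {0..T} (A th)"
    and "\<And>th. th \<in> \<Theta> \<Longrightarrow> continuous_on {0..T} (r th)"
    and "Linf_on T \<zeta>"
    and "\<theta> \<in> \<Theta>"
    and "lam > 0"
    and "transpose Q = Q" and "\<And>x. x \<noteq> 0 \<Longrightarrow> x \<bullet> (Q *v x) > 0"
  shows "(\<exists>E h. riccati_sol T C Q (A \<theta>) lam E \<and> h_sol T C (A \<theta>) (r \<theta>) lam \<zeta> E h)
    \<and> (\<forall>E h. riccati_sol T C Q (A \<theta>) lam E \<and> h_sol T C (A \<theta>) (r \<theta>) lam \<zeta> E h \<longrightarrow>
        (\<exists>ubar xhat.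
           L2_on T ubar
           \<and> (\<forall>u x0. L2_on T u \<longrightarrow>
                cost T C Q (A \<theta>) (r \<theta>) lam \<zeta> ubar xhat \<le> cost T C Q (A \<theta>) (r \<theta>) lam \<zeta> u x0)
           \<and> (\<forall>u x0. L2_on T u \<and>
                cost T C Q (A \<theta>) (r \<theta>) lam \<zeta> u x0 = cost T C Q (A \<theta>) (r \<theta>) lam \<zeta> ubar xhat
                \<longrightarrow> x0 = xhat \<and> (AE t in lborel. t \<in> {0..T} \<longrightarrow> u t = ubar t))
           \<and> (\<forall>t\<in>{0..T}. ubar t =
                (1/lam) *\<^sub>R (E t *v traj T (A \<theta>) (r \<theta>) xhat ubar t + h t))
           \<and> (\<forall>t\<in>{0..T}. transpose (E t) = E t)
           \<and> invertible (E T)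
           \<and> (INF x0. INF u \<in> {u. L2_on T u}. cost T C Q (A \<theta>) (r \<theta>) lam \<zeta> u x0)
               = integral {0..T} (\<lambda>t. (norm (\<zeta> t))\<^sup>2 - 2 * (r \<theta> t \<bullet> h t) - (1/lam) * (norm (h t))\<^sup>2)
                 - h T \<bullet> (matrix_inv (E T) *v h T)
           \<and> traj T (A \<theta>) (r \<theta>) xhat ubar T = - (matrix_inv (E T) *v h T)))"
proof (intro conjI allI impI, goal_cases)
  note A = assms(2)[OF assms(5)] and r = assms(3)[OF assms(5)]
  have T: "0 \<le> T" using assms(1) by simp
  have z: "L2_on T \<zeta>" by (rule Linf_on_imp_L2_on[OF assms(4)])
  note hyps = assms(1) A r z assms(6,7)
  obtain F where F: "riccati_sol T C Q (A \<theta>) lam F"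
    and Fpos: "\<And>t x. \<lbrakk>t \<in> {0..T}; x \<noteq> 0\<rbrakk> \<Longrightarrow> x \<bullet> (F t *v x) > 0"
    using riccati_sol_exists_pos[OF T A assms(6,8)] by blast
  {
    case 1
    show ?case
      using F h_sol_exists[OF hyps riccati_sol_continuous[OF T A F]] by blast
  next
    case (2 E h)
    then have E: "riccati_sol T C Q (A \<theta>) lam E" and h: "h_sol T C (A \<theta>) (r \<theta>) lam \<zeta> E h"
      by auto
    \<comment> \<open>Positivity is known for the constructed solution \<open>F\<close> and passes
      to the given \<open>E\<close> by uniqueness.\<close>
    have "E T = F T" using riccati_sol_unique[OF T A E F] T by simp
    then have pos: "x \<bullet> (E T *v x) > 0" if "x \<noteq> 0" for x using Fpos[of T x] T that by simp
    let ?cost = "cost T C Q (A \<theta>) (r \<theta>) lam \<zeta>"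
    let ?S = "profiled_cost T (r \<theta>) lam \<zeta> E h"
    obtain ubar xhat where opt: "L2_on T ubar" "?cost ubar xhat = ?S"
      "\<forall>u x0. L2_on T u \<longrightarrow> ?S \<le> ?cost u x0"
      "\<forall>u x0. L2_on T u \<and> ?cost u x0 = ?S
        \<longrightarrow> x0 = xhat \<and> (AE t in lborel. t \<in> {0..T} \<longrightarrow> u t = ubar t)"
      "\<forall>t\<in>{0..T}. ubar t = (1/lam) *\<^sub>R (E t *v traj T (A \<theta>) (r \<theta>) xhat ubar t + h t)"
      "traj T (A \<theta>) (r \<theta>) xhat ubar T = - (matrix_inv (E T) *v h T)"
      using optimal_control(2)[OF hyps E h pos] by blast
    have inv: "invertible (E T)" by (rule optimal_control(1)[OF hyps E h pos])
    \<comment> \<open>Real infima need nonempty sets bounded below. \<open>?S\<close> bounds every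
      cost from below, and at \<open>xhat\<close> the inner infimum is attained by
      \<open>ubar\<close>, so the outer one is attained at \<open>xhat\<close>.\<close>
    let ?inner = "\<lambda>x0. INF u \<in> {u. L2_on T u}. ?cost u x0"
    have "?inner xhat = ?S"
      by (rule cInf_eq_minimum) (use opt(1-3) in \<open>auto intro: image_eqI[of _ _ ubar]\<close>)
    moreover have "?S \<le> ?inner x0" for x0
      by (rule cINF_greatest) (use opt(1,3) in auto)
    ultimately have "(INF x0. ?inner x0) = ?S"
      by (intro cInf_eq_minimum) (auto intro: image_eqI[of _ _ xhat])
    moreover have "\<forall>t\<in>{0..T}. transpose (E t) = E t" using E_symmetric[OF hyps E h] by blast
    ultimately show ?case
      using opt(1,3-6) inv unfolding opt(2)[symmetric]
      by (intro exI[of _ ubar] exI[of _ xhat] conjI) (simp_all only: opt(2) profiled_cost_def)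
  }
qed

end
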